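(* Let $\mathcal{S}$ be a semispray on the prolongation $\mathcal{T}E$ of a Lie algebroid $E$, $\mathcal{N}=-\mathcal{L}_{\mathcal{S}}J$ the canonical nonlinear connection, $\nabla$ the dynamical covariant derivative induced by $\mathcal{S}$ and $\mathcal{N}$, and $\Phi$ the Jacobi endomorphism. A section $\widetilde{X}\in\Gamma(E\setminus\{0\})$, locally $\widetilde{X}=\widetilde{X}^\alpha(x,y)s_\alpha$, is a Lie symmetry of $\mathcal{S}$ if and only if $$\nabla^2\widetilde{X}^{v}+\Phi(\widetilde{X}^{c})=0,$$ where $\widetilde{X}^{v}$ and $\widetilde{X}^{c}$ are the vertical and complete lifts of $\widetilde{X}$ to $\mathcal{T}E$.
   Context: Lie algebroid: $\pi:E\to M$ is a vector bundle of rank $m$ over a smooth manifold $M$ of dimension $n$, with a Lie bracket $[\cdot,\cdot]_E$ on $\Gamma(E)$ and a bundle map (anchor) $\sigma:E\to TM$ inducing a Lie algebra homomorphism $\Gamma(E)\to\mathfrak{X}(M)$ with $[s_1,fs_2]_E=f[s_1,s_2]_E+(\sigma(s_1)f)s_2$. In local coordinates $x^i$ and a local basis $\{s_\alpha\}$ of sections (with induced coordinates $(x^i,y^\alpha)$ on $E$), $\sigma(s_\alpha)=\sigma_\alpha^i\,\partial/\partial x^i$, $[s_\alpha,s_\beta]_E=L_{\alpha\beta}^\gamma s_\gamma$; repeated indices are summed. The prolongation $\mathcal{T}E\to E$ has fibre $\mathcal{T}_wE=\{(u,v)\in E_{\pi(w)}\times T_wE:\sigma(u)=T_w\pi(v)\}$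 at $w\in E$. It is a Lie algebroid over $E$ with anchor $\sigma^1(u,v)=v$, local basis $\mathcal{X}_\alpha(w)=(s_\alpha(\pi(w)),\sigma_\alpha^i\partial/\partial x^i|_w)$, $\mathcal{V}_\alpha(w)=(0,\partial/\partial y^\alpha|_w)$, and bracket determined by $[\mathcal{X}_\alpha,\mathcal{X}_\beta]_{\mathcal{T}E}=L_{\alpha\beta}^\gamma\mathcal{X}_\gamma$, $[\mathcal{X}_\alpha,\mathcal{V}_\beta]_{\mathcal{T}E}=0$, $[\mathcal{V}_\alpha,\mathcal{V}_\beta]_{\mathcal{T}E}=0$. The vertical subbundle $V\mathcal{T}E$ is the kernel of $(u,v)\mapsto u$ (spanned by the $\mathcal{V}_\alpha$). The tangent structure $J$ is the $(1,1)$-tensor with $J\mathcal{X}_\alpha=\mathcal{V}_\alpha$, $J\mathcal{V}_\alpha=0$; the Euler section is $\mathbb{C}=y^\alpha\mathcal{V}_\alpha$. A semispray is a section $\mathcal{S}$ of $\mathcal{T}E$ with $J\mathcal{S}=\mathbb{C}$. Here $E\setminus\{0\}$ is $E$ without the zero section, and sections $\widetilde{X}=\widetilde{X}^\alpha(x,y)s_\alpha$ on $E\setminus\{0\}$ may have components depending on both $x$ and $y$. The lifts are given in local coordinates by $\widetilde{X}^{v}=\widetilde{X}^\alpha\mathcal{V}_\alpha$ and $\widetilde{X}^{c}=\widetilde{X}^\alpha\mathcal{X}_\alpha+y^\varepsilon\left(\sigma_\varepsilon^i\frac{\partial\widetilde{X}^\alpha}{\partial x^i}-L_{\beta\varepsilon}^\alpha\widetilde{X}^\beta\right)\mathcal{V}_\alpha$,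 so that $J(\widetilde{X}^{c})=\widetilde{X}^{v}$. The section $\widetilde{X}$ is a Lie symmetry of $\mathcal{S}$ if its complete lift is a dynamical symmetry, that is, $[\mathcal{S},\widetilde{X}^{c}]_{\mathcal{T}E}=0$. A nonlinear connection is a bundle morphism $\mathcal{N}:\mathcal{T}E\to\mathcal{T}E$, smooth on $\mathcal{T}E\setminus\{0\}$, with $\mathcal{N}^2=\mathrm{Id}$ and $V\mathcal{T}E=\ker(\mathrm{Id}+\mathcal{N})$; its projectors are $\mathrm{h}=\frac12(\mathrm{Id}+\mathcal{N})$, $\mathrm{v}=\frac12(\mathrm{Id}-\mathcal{N})$. For sections, $\mathcal{L}_XY=[X,Y]_{\mathcal{T}E}$; for a $(1,1)$-tensor field $T$, $\mathcal{L}_XT=\mathcal{L}_X\circ T-T\circ\mathcal{L}_X$. The dynamical covariant derivative is $\nabla=\mathrm{h}\circ\mathcal{L}_{\mathcal{S}}\circ\mathrm{h}+\mathrm{v}\circ\mathcal{L}_{\mathcal{S}}\circ\mathrm{v}$ on sections, $\nabla^2=\nabla\circ\nabla$; the Jacobi endomorphism is $\Phi=-\mathrm{v}\circ\mathcal{L}_{\mathcal{S}}\mathrm{v}$.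
   Formalization: For y-dependent components the "if" direction fails (E=Tℝ, S=y∂x+∂y, X=y), so it is proved with the added condition S^β ∂X^α/∂y^β = 0 (S^β the vertical coefficients of S), automatic when X depends on x only; "only if" is proved for all X. *)

theory Defs
  imports "HOL-Analysis.Analysis"
begin

section \<open>Smooth maps and tangent vectors\<close>

primrec Ck_on :: "nat \<Rightarrow> 'a::euclidean_space set \<Rightarrow> ('a \<Rightarrow> 'b::real_normed_vector) \<Rightarrow> bool" where
  "Ck_on 0 U f \<longleftrightarrow> continuous_on U f"
| "Ck_on (Suc k) U f \<longleftrightarrow>
     f differentiable_on U \<and> (\<forall>v. Ck_on k U (\<lambda>x. frechet_derivative f (at x) v))"

text \<open>Only meant for open \<open>U\<close>.\<close>

definition smooth_on :: "'a::euclidean_space set \<Rightarrow> ('a \<Rightarrow> 'b::real_normed_vector) \<Rightarrow> bool" where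
  "smooth_on U f \<longleftrightarrow> (\<forall>k. Ck_on k U f)"

text \<open>A chart of a manifold is a pair of its domain and its coordinate map.\<close>

type_synonym ('q, 'a) chart = "'q set \<times> ('q \<Rightarrow> 'a)"

definition chart_inv :: "('q, 'a) chart \<Rightarrow> 'a \<Rightarrow> 'q" where
  "chart_inv \<phi> = inv_into (fst \<phi>) (snd \<phi>)"

definition smooth_near :: "('q, 'a::euclidean_space) chart \<Rightarrow> 'q \<Rightarrow> ('q \<Rightarrow> real) \<Rightarrow> bool" where
  "smooth_near \<phi> q f \<longleftrightarrow>
     (\<exists>V. open V \<and> snd \<phi> q \<in> V \<and> V \<subseteq> snd \<phi> ` fst \<phi> \<and> smooth_on V (f \<circ> chart_inv \<phi>))"

text \<open>Tangent vectors at \<open>q\<close> are derivations on the functions that are smooth near \<open>q\<close>. They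
  are extended by \<open>0\<close> to all functions, so that equal derivations are equal as functionals.\<close>

type_synonym 'q tangent = "('q \<Rightarrow> real) \<Rightarrow> real"

definition dir_deriv :: "('q, 'a::euclidean_space) chart \<Rightarrow> 'q \<Rightarrow> 'a \<Rightarrow> 'q tangent" where
  "dir_deriv \<phi> q \<xi> = (\<lambda>f. if smooth_near \<phi> q f
     then frechet_derivative (f \<circ> chart_inv \<phi>) (at (snd \<phi> q)) \<xi> else 0)"

text \<open>For an atlas with smooth transition maps it makes no difference whether the following is
  required in one chart around \<open>q\<close> or in every chart around \<open>q\<close>.\<close>

definition tangent_space :: "('q, 'a::euclidean_space) chart set \<Rightarrow> 'q \<Rightarrow> 'q tangent set" where
  "tangent_space \<A> q = {v. \<forall>\<phi>\<in>\<A>. q \<in> fst \<phi> \<longrightarrow> (\<exists>\<xi>. v = dir_deriv \<phi> q \<xi>)}"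

section \<open>Vector bundles\<close>

text \<open>A bundle chart is a chart \<open>xc\<close> of the base on \<open>cdom\<close> together with fibre coordinates \<open>yc\<close> on
  the part of the total space over \<open>cdom\<close>: the local coordinates \<open>(x, y)\<close> of the bundle.\<close>

record ('p, 'e, 'n, 'm) bchart =
  cdom :: "'p set"
  xc :: "'p \<Rightarrow> real ^ 'n"
  yc :: "'e \<Rightarrow> real ^ 'm"

record ('p, 'e, 'n, 'm) vbundle =
  base :: "'p topology"
  proj :: "'e \<Rightarrow> 'p"
  vadd :: "'e \<Rightarrow> 'e \<Rightarrow> 'e"
  vscale :: "real \<Rightarrow> 'e \<Rightarrow> 'e"
  vzero :: "'p \<Rightarrow> 'e"
  atlas :: "('p, 'e, 'n, 'm) bchart set"

definition fibre :: "('p, 'e, 'n::finite, 'm::finite, 'z) vbundle_scheme \<Rightarrow> 'p \<Rightarrow> 'e set" where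
  "fibre B p = {e. proj B e = p}"

definition xchart :: "('p, 'e, 'n::finite, 'm::finite) bchart \<Rightarrow> ('p, real ^ 'n) chart" where
  "xchart c = (cdom c, xc c)"

definition frame ::
  "('p, 'e, 'n::finite, 'm::finite, 'z) vbundle_scheme \<Rightarrow> ('p, 'e, 'n, 'm) bchart \<Rightarrow> 'm \<Rightarrow> 'p \<Rightarrow> 'e" where
  "frame B c \<alpha> p = inv_into (fibre B p) (yc c) (axis \<alpha> 1)"

definition smooth_section_on ::
  "('p, 'e, 'n::finite, 'm::finite, 'z) vbundle_scheme \<Rightarrow> 'p set \<Rightarrow> ('p \<Rightarrow> 'e) \<Rightarrow> bool" where
  "smooth_section_on B V s \<longleftrightarrow> (\<forall>p\<in>V. s p \<in> fibre B p) \<and>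
     (\<forall>c\<in>atlas B. smooth_on (xc c ` (V \<inter> cdom c)) (yc c \<circ> s \<circ> chart_inv (xchart c)))"

definition smooth_fun_on ::
  "('p, 'e, 'n::finite, 'm::finite, 'z) vbundle_scheme \<Rightarrow> 'p set \<Rightarrow> ('p \<Rightarrow> real) \<Rightarrow> bool" where
  "smooth_fun_on B V f \<longleftrightarrow> (\<forall>c\<in>atlas B. smooth_on (xc c ` (V \<inter> cdom c)) (f \<circ> chart_inv (xchart c)))"

text \<open>The last condition says that the transition matrices between the local frames are smooth.
  The topology and the smooth structure of the total space are the ones induced by the bundle
  charts.\<close>

definition vector_bundle :: "('p, 'e, 'n::finite, 'm::finite, 'z) vbundle_scheme \<Rightarrow> bool" where
  "vector_bundle B \<longleftrightarrow>
     Hausdorff_space (base B) \<and> second_countable (base B) \<and>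
     (\<Union>c\<in>atlas B. cdom c) = topspace (base B) \<and>
     (\<forall>c\<in>atlas B. openin (base B) (cdom c) \<and> open (xc c ` cdom c) \<and>
        homeomorphic_map (subtopology (base B) (cdom c)) (top_of_set (xc c ` cdom c)) (xc c)) \<and>
     (\<forall>c\<in>atlas B. \<forall>d\<in>atlas B.
        smooth_on (xc c ` (cdom c \<inter> cdom d)) (xc d \<circ> chart_inv (xchart c))) \<and>
     (\<forall>p\<in>topspace (base B). vzero B p \<in> fibre B p \<and>
        (\<forall>e\<in>fibre B p. \<forall>e'\<in>fibre B p. vadd B e e' \<in> fibre B p) \<and>
        (\<forall>r. \<forall>e\<in>fibre B p. vscale B r e \<in> fibre B p)) \<and>
     (\<forall>c\<in>atlas B. \<forall>p\<in>cdom c. bij_betw (yc c) (fibre B p) UNIV \<and> yc c (vzero B p) = 0 \<and>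
        (\<forall>e\<in>fibre B p. \<forall>e'\<in>fibre B p. yc c (vadd B e e') = yc c e + yc c e') \<and>
        (\<forall>r. \<forall>e\<in>fibre B p. yc c (vscale B r e) = r *\<^sub>R yc c e)) \<and>
     (\<forall>c\<in>atlas B. \<forall>d\<in>atlas B. \<forall>\<alpha>. smooth_on (xc d ` (cdom c \<inter> cdom d))
        (yc d \<circ> frame B c \<alpha> \<circ> chart_inv (xchart d)))"

definition sec_add ::
  "('p, 'e, 'n::finite, 'm::finite, 'z) vbundle_scheme \<Rightarrow> ('p \<Rightarrow> 'e) \<Rightarrow> ('p \<Rightarrow> 'e) \<Rightarrow> 'p \<Rightarrow> 'e" where
  "sec_add B s t p = vadd B (s p) (t p)"

definition sec_scale ::
  "('p, 'e, 'n::finite, 'm::finite, 'z) vbundle_scheme \<Rightarrow> ('p \<Rightarrow> real) \<Rightarrow> ('p \<Rightarrow> 'e) \<Rightarrow> 'p \<Rightarrow> 'e" where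
  "sec_scale B f s p = vscale B (f p) (s p)"

section \<open>Lie algebroids\<close>

text \<open>\<open>bracket V\<close> is the bracket of sections over the open set \<open>V\<close>.\<close>

record ('p, 'e, 'n, 'm) lie_algebroid = "('p, 'e, 'n, 'm) vbundle" +
  anchor :: "'e \<Rightarrow> 'p tangent"
  bracket :: "'p set \<Rightarrow> ('p \<Rightarrow> 'e) \<Rightarrow> ('p \<Rightarrow> 'e) \<Rightarrow> 'p \<Rightarrow> 'e"

type_synonym ('p, 'e, 'n, 'm) alg = "('p, 'e, 'n, 'm) lie_algebroid"

definition anchor_coeff ::
  "('p, 'e, 'n::finite, 'm::finite) alg \<Rightarrow> ('p, 'e, 'n, 'm) bchart \<Rightarrow> 'm \<Rightarrow> 'n \<Rightarrow> 'p \<Rightarrow> real" where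
  "anchor_coeff A c \<alpha> i p = anchor A (frame A c \<alpha> p) (\<lambda>q. xc c q $ i)"

definition is_anchor :: "('p, 'e, 'n::finite, 'm::finite) alg \<Rightarrow> bool" where
  "is_anchor A \<longleftrightarrow>
     (\<forall>p\<in>topspace (base A). \<forall>e\<in>fibre A p.
        anchor A e \<in> tangent_space (xchart ` atlas A) p \<and>
        (\<forall>e'\<in>fibre A p. \<forall>f. anchor A (vadd A e e') f = anchor A e f + anchor A e' f) \<and>
        (\<forall>r f. anchor A (vscale A r e) f = r * anchor A e f)) \<and>
     (\<forall>c\<in>atlas A. \<forall>\<alpha> i. smooth_on (xc c ` cdom c) (anchor_coeff A c \<alpha> i \<circ> chart_inv (xchart c)))"

text \<open>The first two conditions make the bracket an operation on the sheaf of sections.\<close>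

definition is_lie_bracket :: "('p, 'e, 'n::finite, 'm::finite) alg \<Rightarrow> bool" where
  "is_lie_bracket A \<longleftrightarrow>
     (\<forall>V s t. openin (base A) V \<and> smooth_section_on A V s \<and> smooth_section_on A V t \<longrightarrow>
        smooth_section_on A V (bracket A V s t)) \<and>
     (\<forall>V W s t s' t'. openin (base A) V \<and> openin (base A) W \<and> W \<subseteq> V \<and>
        smooth_section_on A V s \<and> smooth_section_on A V t \<and>
        (\<forall>p\<in>W. s' p = s p \<and> t' p = t p) \<longrightarrow>
        (\<forall>p\<in>W. bracket A W s' t' p = bracket A V s t p)) \<and>
     (\<forall>V s t u r. openin (base A) V \<and>
        smooth_section_on A V s \<and> smooth_section_on A V t \<and> smooth_section_on A V u \<longrightarrow>
        (\<forall>p\<in>V. bracket A V (sec_add A s t) u p =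
                  vadd A (bracket A V s u p) (bracket A V t u p) \<and>
                bracket A V (sec_scale A (\<lambda>_. r) s) u p = vscale A r (bracket A V s u p) \<and>
                bracket A V s t p = vscale A (- 1) (bracket A V t s p) \<and>
                vadd A (bracket A V s (bracket A V t u) p)
                  (vadd A (bracket A V t (bracket A V u s) p)
                          (bracket A V u (bracket A V s t) p)) = vzero A p)) \<and>
     (\<forall>V s t f. openin (base A) V \<and>
        smooth_section_on A V s \<and> smooth_section_on A V t \<and> smooth_fun_on A V f \<longrightarrow>
        (\<forall>p\<in>V. bracket A V s (sec_scale A f t) p =
                  vadd A (vscale A (f p) (bracket A V s t p)) (vscale A (anchor A (s p) f) (t p)) \<and>
                anchor A (bracket A V s t p) f =
                  anchor A (s p) (\<lambda>q. anchor A (t q) f) - anchor A (t p) (\<lambda>q. anchor A (s q) f)))"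

definition lie_algebroid :: "('p, 'e, 'n::finite, 'm::finite) alg \<Rightarrow> bool" where
  "lie_algebroid A \<longleftrightarrow> vector_bundle A \<and> is_anchor A \<and> is_lie_bracket A"

text \<open>\<open>struct_fun A c \<alpha> \<beta> \<gamma>\<close> is the coefficient \<open>L\<^sub>\<alpha>\<^sub>\<beta>\<^sup>\<gamma>\<close> of \<open>s\<^sub>\<gamma>\<close> in the bracket of \<open>s\<^sub>\<alpha>\<close> and \<open>s\<^sub>\<beta>\<close>.\<close>

definition struct_fun ::
  "('p, 'e, 'n::finite, 'm::finite) alg \<Rightarrow> ('p, 'e, 'n, 'm) bchart \<Rightarrow> 'm \<Rightarrow> 'm \<Rightarrow> 'm \<Rightarrow> 'p \<Rightarrow> real" where
  "struct_fun A c \<alpha> \<beta> \<gamma> p = yc c (bracket A (cdom c) (frame A c \<alpha>) (frame A c \<beta>) p) $ \<gamma>"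

section \<open>The prolongation over the total space\<close>

definition edom :: "('p, 'e, 'n::finite, 'm::finite) alg \<Rightarrow> ('p, 'e, 'n, 'm) bchart \<Rightarrow> 'e set" where
  "edom A c = {w. proj A w \<in> cdom c}"

definition echart ::
  "('p, 'e, 'n::finite, 'm::finite) alg \<Rightarrow> ('p, 'e, 'n, 'm) bchart \<Rightarrow> ('e, (real ^ 'n) \<times> (real ^ 'm)) chart" where
  "echart A c = (edom A c, \<lambda>w. (xc c (proj A w), yc c w))"

definition nonzero :: "('p, 'e, 'n::finite, 'm::finite) alg \<Rightarrow> 'e set" where
  "nonzero A = {w. proj A w \<in> topspace (base A) \<and> w \<noteq> vzero A (proj A w)}"

type_synonym 'e pvec = "'e \<times> 'e tangent"

definition prolong_fibre :: "('p, 'e, 'n::finite, 'm::finite) alg \<Rightarrow> 'e \<Rightarrow> 'e pvec set" where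
  "prolong_fibre A w = {(u, v). u \<in> fibre A (proj A w) \<and>
     v \<in> tangent_space (echart A ` atlas A) w \<and> anchor A u = (\<lambda>f. v (f \<circ> proj A))}"

definition partial_x ::
  "('p, 'e, 'n::finite, 'm::finite) alg \<Rightarrow> ('p, 'e, 'n, 'm) bchart \<Rightarrow> 'n \<Rightarrow> 'e \<Rightarrow> 'e tangent" where
  "partial_x A c i w = dir_deriv (echart A c) w (axis i 1, 0)"

definition partial_y ::
  "('p, 'e, 'n::finite, 'm::finite) alg \<Rightarrow> ('p, 'e, 'n, 'm) bchart \<Rightarrow> 'm \<Rightarrow> 'e \<Rightarrow> 'e tangent" where
  "partial_y A c \<alpha> w = dir_deriv (echart A c) w (0, axis \<alpha> 1)"

definition Xframe ::
  "('p, 'e, 'n::finite, 'm::finite) alg \<Rightarrow> ('p, 'e, 'n, 'm) bchart \<Rightarrow> 'm \<Rightarrow> 'e \<Rightarrow> 'e pvec" where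
  "Xframe A c \<alpha> w = (frame A c \<alpha> (proj A w),
     \<lambda>f. \<Sum>i\<in>UNIV. anchor_coeff A c \<alpha> i (proj A w) * partial_x A c i w f)"

definition Vframe ::
  "('p, 'e, 'n::finite, 'm::finite) alg \<Rightarrow> ('p, 'e, 'n, 'm) bchart \<Rightarrow> 'm \<Rightarrow> 'e \<Rightarrow> 'e pvec" where
  "Vframe A c \<alpha> w = (vzero A (proj A w), partial_y A c \<alpha> w)"

text \<open>The combination of the \<open>Xframe\<close> with coefficients \<open>a\<close> and the \<open>Vframe\<close> with
  coefficients \<open>b\<close>; its part in \<open>E\<close> is the vector with fibre coordinates \<open>a\<close>.\<close>

definition frame_comb :: "('p, 'e, 'n::finite, 'm::finite) alg \<Rightarrow> ('p, 'e, 'n, 'm) bchart \<Rightarrow>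
    real ^ 'm \<Rightarrow> real ^ 'm \<Rightarrow> 'e \<Rightarrow> 'e pvec" where
  "frame_comb A c a b w = (inv_into (fibre A (proj A w)) (yc c) a,
     \<lambda>f. \<Sum>\<alpha>\<in>UNIV. a $ \<alpha> * snd (Xframe A c \<alpha> w) f + b $ \<alpha> * snd (Vframe A c \<alpha> w) f)"

type_synonym 'e psection = "'e \<Rightarrow> 'e pvec"

text \<open>The coefficients of a section in that frame: \<open>Xframe\<close> annihilates the fibre coordinates.\<close>

definition Xcoeff :: "('p, 'e, 'n::finite, 'm::finite) bchart \<Rightarrow> 'e psection \<Rightarrow> 'e \<Rightarrow> real ^ 'm" where
  "Xcoeff c Z w = yc c (fst (Z w))"

definition Vcoeff :: "('p, 'e, 'n::finite, 'm::finite) bchart \<Rightarrow> 'e psection \<Rightarrow> 'e \<Rightarrow> real ^ 'm" where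
  "Vcoeff c Z w = (\<chi> \<alpha>. snd (Z w) (\<lambda>e. yc c e $ \<alpha>))"

definition smooth_psection :: "('p, 'e, 'n::finite, 'm::finite) alg \<Rightarrow> 'e psection \<Rightarrow> bool" where
  "smooth_psection A Z \<longleftrightarrow> (\<forall>w\<in>nonzero A. Z w \<in> prolong_fibre A w) \<and>
     (\<forall>c\<in>atlas A.
        smooth_on (snd (echart A c) ` (edom A c \<inter> nonzero A)) (Xcoeff c Z \<circ> chart_inv (echart A c)) \<and>
        smooth_on (snd (echart A c) ` (edom A c \<inter> nonzero A)) (Vcoeff c Z \<circ> chart_inv (echart A c)))"

definition psec_add :: "('p, 'e, 'n::finite, 'm::finite) alg \<Rightarrow>
    'e psection \<Rightarrow> 'e psection \<Rightarrow> 'e psection" where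
  "psec_add A Y Z w = (vadd A (fst (Y w)) (fst (Z w)), \<lambda>f. snd (Y w) f + snd (Z w) f)"

definition psec_scale :: "('p, 'e, 'n::finite, 'm::finite) alg \<Rightarrow> real \<Rightarrow> 'e psection \<Rightarrow> 'e psection" where
  "psec_scale A r Z w = (vscale A r (fst (Z w)), \<lambda>f. r * snd (Z w) f)"

definition psec_diff :: "('p, 'e, 'n::finite, 'm::finite) alg \<Rightarrow>
    'e psection \<Rightarrow> 'e psection \<Rightarrow> 'e psection" where
  "psec_diff A Y Z = psec_add A Y (psec_scale A (- 1) Z)"

definition pzero :: "('p, 'e, 'n::finite, 'm::finite) alg \<Rightarrow> 'e psection" where
  "pzero A w = (vzero A (proj A w), \<lambda>f. 0)"

text \<open>The Leibniz extension of the brackets of the frame, with \<open>snd\<close> as anchor. It is given in the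
  bundle chart \<open>c\<close>, on the part of the total space over \<open>cdom c\<close>, and so are the tensors and
  derivations built from it. None of them depends on the chart on overlaps.\<close>

definition pbracket :: "('p, 'e, 'n::finite, 'm::finite) alg \<Rightarrow> ('p, 'e, 'n, 'm) bchart \<Rightarrow>
    'e psection \<Rightarrow> 'e psection \<Rightarrow> 'e psection" where
  "pbracket A c Y Z w = frame_comb A c
     (\<chi> \<gamma>. snd (Y w) (\<lambda>e. Xcoeff c Z e $ \<gamma>) - snd (Z w) (\<lambda>e. Xcoeff c Y e $ \<gamma>)
        + (\<Sum>\<alpha>\<in>UNIV. \<Sum>\<beta>\<in>UNIV.
             struct_fun A c \<alpha> \<beta> \<gamma> (proj A w) * Xcoeff c Y w $ \<alpha> * Xcoeff c Z w $ \<beta>))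
     (\<chi> \<gamma>. snd (Y w) (\<lambda>e. Vcoeff c Z e $ \<gamma>) - snd (Z w) (\<lambda>e. Vcoeff c Y e $ \<gamma>)) w"

definition tangent_str :: "('p, 'e, 'n::finite, 'm::finite) alg \<Rightarrow> ('p, 'e, 'n, 'm) bchart \<Rightarrow>
    'e psection \<Rightarrow> 'e psection" where
  "tangent_str A c Z w = frame_comb A c 0 (Xcoeff c Z w) w"

definition euler :: "('p, 'e, 'n::finite, 'm::finite) alg \<Rightarrow> ('p, 'e, 'n, 'm) bchart \<Rightarrow> 'e psection" where
  "euler A c w = frame_comb A c 0 (yc c w) w"

definition semispray :: "('p, 'e, 'n::finite, 'm::finite) alg \<Rightarrow> 'e psection \<Rightarrow> bool" where
  "semispray A S \<longleftrightarrow> smooth_psection A S \<and>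
     (\<forall>c\<in>atlas A. \<forall>w\<in>edom A c \<inter> nonzero A. tangent_str A c S w = euler A c w)"

section \<open>Canonical nonlinear connection, covariant derivative, Jacobi endomorphism\<close>

definition lie_deriv_tensor :: "('p, 'e, 'n::finite, 'm::finite) alg \<Rightarrow> ('p, 'e, 'n, 'm) bchart \<Rightarrow>
    'e psection \<Rightarrow> ('e psection \<Rightarrow> 'e psection) \<Rightarrow> 'e psection \<Rightarrow> 'e psection" where
  "lie_deriv_tensor A c Y T Z = psec_diff A (pbracket A c Y (T Z)) (T (pbracket A c Y Z))"

definition canon_conn :: "('p, 'e, 'n::finite, 'm::finite) alg \<Rightarrow> ('p, 'e, 'n, 'm) bchart \<Rightarrow>
    'e psection \<Rightarrow> 'e psection \<Rightarrow> 'e psection" where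
  "canon_conn A c S Z = psec_scale A (- 1) (lie_deriv_tensor A c S (tangent_str A c) Z)"

definition hproj :: "('p, 'e, 'n::finite, 'm::finite) alg \<Rightarrow> ('p, 'e, 'n, 'm) bchart \<Rightarrow>
    'e psection \<Rightarrow> 'e psection \<Rightarrow> 'e psection" where
  "hproj A c S Z = psec_scale A (1/2) (psec_add A Z (canon_conn A c S Z))"

definition vproj :: "('p, 'e, 'n::finite, 'm::finite) alg \<Rightarrow> ('p, 'e, 'n, 'm) bchart \<Rightarrow>
    'e psection \<Rightarrow> 'e psection \<Rightarrow> 'e psection" where
  "vproj A c S Z = psec_scale A (1/2) (psec_diff A Z (canon_conn A c S Z))"

definition dyn_deriv :: "('p, 'e, 'n::finite, 'm::finite) alg \<Rightarrow> ('p, 'e, 'n, 'm) bchart \<Rightarrow>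
    'e psection \<Rightarrow> 'e psection \<Rightarrow> 'e psection" where
  "dyn_deriv A c S Z = psec_add A
     (hproj A c S (pbracket A c S (hproj A c S Z)))
     (vproj A c S (pbracket A c S (vproj A c S Z)))"

definition jacobi_endo :: "('p, 'e, 'n::finite, 'm::finite) alg \<Rightarrow> ('p, 'e, 'n, 'm) bchart \<Rightarrow>
    'e psection \<Rightarrow> 'e psection \<Rightarrow> 'e psection" where
  "jacobi_endo A c S Z =
     psec_scale A (- 1) (vproj A c S (lie_deriv_tensor A c S (vproj A c S) Z))"

section \<open>Lifts and Lie symmetries\<close>

text \<open>A section of \<open>E\<close> whose components may depend on the fibre coordinates.\<close>

definition fibre_dep_section :: "('p, 'e, 'n::finite, 'm::finite) alg \<Rightarrow> ('e \<Rightarrow> 'e) \<Rightarrow> bool" where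
  "fibre_dep_section A X \<longleftrightarrow> (\<forall>w\<in>nonzero A. X w \<in> fibre A (proj A w)) \<and>
     (\<forall>c\<in>atlas A.
        smooth_on (snd (echart A c) ` (edom A c \<inter> nonzero A)) (yc c \<circ> X \<circ> chart_inv (echart A c)))"

definition vert_lift :: "('p, 'e, 'n::finite, 'm::finite) alg \<Rightarrow> ('p, 'e, 'n, 'm) bchart \<Rightarrow>
    ('e \<Rightarrow> 'e) \<Rightarrow> 'e psection" where
  "vert_lift A c X w = frame_comb A c 0 (yc c (X w)) w"

text \<open>Unlike the vertical lift, this depends on the chart when the components of \<open>X\<close> depend on the
  fibre coordinates: a linear change of the \<open>y\<close> with \<open>x\<close>-dependent coefficients changes the partial
  derivatives along \<open>x\<close> by derivatives along \<open>y\<close>.\<close>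

definition compl_lift :: "('p, 'e, 'n::finite, 'm::finite) alg \<Rightarrow> ('p, 'e, 'n, 'm) bchart \<Rightarrow>
    ('e \<Rightarrow> 'e) \<Rightarrow> 'e psection" where
  "compl_lift A c X w = frame_comb A c (yc c (X w))
     (\<chi> \<alpha>. \<Sum>\<epsilon>\<in>UNIV. yc c w $ \<epsilon> *
        ((\<Sum>i\<in>UNIV. anchor_coeff A c \<epsilon> i (proj A w) * partial_x A c i w (\<lambda>e. yc c (X e) $ \<alpha>))
         - (\<Sum>\<beta>\<in>UNIV. struct_fun A c \<beta> \<epsilon> \<alpha> (proj A w) * yc c (X w) $ \<beta>))) w"

definition lie_symmetry_on :: "('p, 'e, 'n::finite, 'm::finite) alg \<Rightarrow> ('p, 'e, 'n, 'm) bchart \<Rightarrow>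
    'e psection \<Rightarrow> ('e \<Rightarrow> 'e) \<Rightarrow> bool" where
  "lie_symmetry_on A c S X \<longleftrightarrow>
     (\<forall>w\<in>edom A c \<inter> nonzero A. pbracket A c S (compl_lift A c X) w = pzero A w)"

text \<open>\<open>X\<close> is the pullback of a section over \<open>cdom c\<close>: its components depend on \<open>x\<close> only.\<close>

definition basic_on :: "('p, 'e, 'n::finite, 'm::finite) alg \<Rightarrow> ('p, 'e, 'n, 'm) bchart \<Rightarrow>
    ('e \<Rightarrow> 'e) \<Rightarrow> bool" where
  "basic_on A c X \<longleftrightarrow>
     (\<forall>w\<in>edom A c \<inter> nonzero A. \<forall>w'\<in>edom A c \<inter> nonzero A. proj A w = proj A w' \<longrightarrow> X w = X w')"

text \<open>The derivative of the components of \<open>X\<close> along the fibre directions, in the direction of the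
  vertical coefficients of \<open>S\<close>, vanishes. Every basic section has this property. For a semispray
  \<open>S\<close> the left-hand side is the \<open>Xframe\<close> coefficient of the bracket of \<open>S\<close> with the complete lift.\<close>

definition fibre_const_along :: "('p, 'e, 'n::finite, 'm::finite) alg \<Rightarrow> ('p, 'e, 'n, 'm) bchart \<Rightarrow>
    'e psection \<Rightarrow> ('e \<Rightarrow> 'e) \<Rightarrow> bool" where
  "fibre_const_along A c S X \<longleftrightarrow> (\<forall>w\<in>edom A c \<inter> nonzero A. \<forall>\<alpha>.
     (\<Sum>\<beta>\<in>UNIV. Vcoeff c S w $ \<beta> * partial_y A c \<beta> w (\<lambda>e. yc c (X e) $ \<alpha>)) = 0)"

end

theory Submission
  imports Defs
begin

text \<open>
  Write a section of the prolongation in a bundle chart as a pair \<open>(p, q)\<close> of vectors of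
  coefficient functions with respect to the frames \<open>\<X>\<^sub>\<alpha>\<close> and \<open>\<V>\<^sub>\<alpha>\<close>. A semispray is \<open>S = (y, s)\<close>. Let \<open>D\<close> be
  the derivative along \<open>S\<close> applied to coefficients, and consider the matrices \<open>G = \<partial>s/\<partial>y\<close>,
  \<open>R\<close> with columns \<open>\<sigma>(s\<^sub>\<alpha>) s\<close>, \<open>\<Lambda>\<close> (the structure functions contracted with \<open>y\<close>) and
  \<open>B = (G + \<Lambda>) / 2\<close>. Then

  \<^item> \<open>[S, (p, q)] = (D p - q + \<Lambda> p, D q - R p - G q)\<close>;
  \<^item> the projectors of the canonical connection are \<open>h (p, q) = (p, B p)\<close> and \<open>v (p, q) = (0, q - B p)\<close>;
  \<^item> on vertical sections \<open>\<nabla> (0, q) = (0, D q + (\<Lambda> - B) q)\<close>;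
  \<^item> \<open>\<Phi> (p, q) = (0, D (B p) - R p - G B p - B (D p + \<Lambda> p - B p))\<close>.

  Let \<open>p\<close> be the components of \<open>X\<close> and \<open>F p\<close> their derivative along the vertical field
  \<open>s\<^sup>\<beta> \<partial>/\<partial>y\<^sup>\<beta>\<close>. As \<open>L\<close> is antisymmetric, the complete lift is \<open>(p, q)\<close> with \<open>q = D p + \<Lambda> p - F p\<close>.
  Hence the \<open>\<X>\<close> part of \<open>[S, X\<^sup>c]\<close> is \<open>F p\<close>. Substituting \<open>D p + (\<Lambda> - B) p = q + F p - B p\<close> in
  \<open>\<nabla>\<^sup>2 X\<^sup>v\<close>, the terms \<open>D (B p)\<close> cancel against those of \<open>\<Phi>\<close>, and all terms quadratic in \<open>G\<close> and \<open>\<Lambda>\<close>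
  cancel because \<open>\<Lambda> - B = B - G\<close>. What is left of \<open>\<nabla>\<^sup>2 X\<^sup>v + \<Phi> (X\<^sup>c)\<close> is the \<open>\<V>\<close> part of \<open>[S, X\<^sup>c]\<close> plus
  \<open>D (F p) - G (F p)\<close> (lemmas \<open>represents_bracket_compl_lift\<close> and \<open>represents_jacobi\<close>). So where \<open>F p\<close>
  vanishes identically, the Jacobi equation and the symmetry condition are the same equation; and
  \<open>F p = 0\<close> is the \<open>\<X>\<close> part of the symmetry condition. It holds for basic sections, whose
  components do not change along the fibres.

  Tangent vectors are functionals that send functions without local smoothness to \<open>0\<close>, so linearity
  of \<open>D\<close> is available only between smooth functions. Hence every coefficient field that
  occurs in the computation is shown to be smooth along with it.
\<close>

section \<open>Calculus of smooth maps on open sets\<close>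

text \<open>The two functions have the same derivatives in the sense of \<open>has_derivative\<close>, so the
  choice operator returns the same value for both.\<close>

lemma frechet_derivative_cong_open:
  assumes "open U" "x \<in> U" "\<And>y. y \<in> U \<Longrightarrow> f y = g y"
  shows "frechet_derivative f (at x) = frechet_derivative g (at x)"
proof -
  have "(f has_derivative f') (at x) \<longleftrightarrow> (g has_derivative f') (at x)" for f'
    using assms has_derivative_transform_within_open[of f f' x UNIV U g]
      has_derivative_transform_within_open[of g f' x UNIV U f] by auto
  then show ?thesis
    by (simp add: frechet_derivative_def)
qed

lemma Ck_on_cong:
  assumes "open U" "\<And>x. x \<in> U \<Longrightarrow> f x = g x" "Ck_on k U f"
  shows "Ck_on k U g"
  using assms(2,3)
proof (induction k arbitrary: f g)
  case 0
  then show ?case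
    using continuous_on_cong[of U U f g] by simp
next
  case (Suc k)
  have "g differentiable_on U"
    using Suc.prems differentiable_transform_within[of f _ U 1 g]
    by (auto simp: differentiable_on_def)
  moreover have "Ck_on k U (\<lambda>x. frechet_derivative g (at x) v)" for v
  proof (rule Suc.IH[of "\<lambda>x. frechet_derivative f (at x) v"])
    show "frechet_derivative f (at x) v = frechet_derivative g (at x) v" if "x \<in> U" for x
      using frechet_derivative_cong_open[OF assms(1) that Suc.prems(1)] by simp
  qed (use Suc.prems(2) in simp)
  ultimately show ?case
    by simp
qed

lemma Ck_on_SucD: "Ck_on (Suc k) U f \<Longrightarrow> Ck_on k U f"
proof (induction k arbitrary: f)
  case 0
  then show ?case
    by (simp add: differentiable_imp_continuous_on)
next
  case (Suc k)
  then show ?case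
    by (metis Ck_on.simps(2))
qed

lemma Ck_on_has_derivative:
  assumes "open U" "Ck_on (Suc k) U f" "x \<in> U"
  shows "(f has_derivative frechet_derivative f (at x)) (at x)"
proof -
  have "f differentiable (at x)"
    using assms differentiable_on_eq_differentiable_at by auto
  then show ?thesis
    by (simp add: frechet_derivative_works)
qed

text \<open>The induction principle behind the closure properties below: it suffices to know some
  derivative in closed form and to check that its directional components are of class \<open>C\<^sup>k\<close>.\<close>

lemma Ck_on_SucI:
  assumes "open U" "\<And>x. x \<in> U \<Longrightarrow> (f has_derivative f' x) (at x)"
    and "\<And>v. Ck_on k U (\<lambda>x. f' x v)"
  shows "Ck_on (Suc k) U f"
proof -
  have "f differentiable_on U"
    using assms(1,2) differentiable_on_eq_differentiable_at differentiable_def by blast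
  moreover have "Ck_on k U (\<lambda>x. frechet_derivative f (at x) v)" for v
    by (rule Ck_on_cong[OF assms(1) _ assms(3)[of v]]) (simp add: frechet_derivative_at[OF assms(2), symmetric])
  ultimately show ?thesis
    by simp
qed

lemma Ck_on_const: "open U \<Longrightarrow> Ck_on k U (\<lambda>_. a)"
proof (induction k arbitrary: a)
  case (Suc k)
  then show ?case
    by (intro Ck_on_SucI[where f' = "\<lambda>_ _. 0"]) auto
qed simp

lemma Ck_on_add:
  assumes "open U" "Ck_on k U f" "Ck_on k U g"
  shows "Ck_on k U (\<lambda>x. f x + g x)"
  using assms(2,3)
proof (induction k arbitrary: f g)
  case (Suc k)
  show ?case
    by (rule Ck_on_SucI[OF assms(1) has_derivative_add[OF Ck_on_has_derivative[OF assms(1) Suc.prems(1)]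
          Ck_on_has_derivative[OF assms(1) Suc.prems(2)]]]) (use Suc in auto)
qed (simp add: continuous_on_add)

lemma Ck_on_mult:
  fixes f g :: "'a::euclidean_space \<Rightarrow> real"
  assumes "open U" "Ck_on k U f" "Ck_on k U g"
  shows "Ck_on k U (\<lambda>x. f x * g x)"
  using assms(2,3)
proof (induction k arbitrary: f g)
  case (Suc k)
  have deriv: "Ck_on k U (\<lambda>x. f x * frechet_derivative g (at x) v + frechet_derivative f (at x) v * g x)" for v
    using Suc.prems Ck_on_SucD by (intro Ck_on_add[OF assms(1)] Suc.IH) auto
  show ?case
    by (rule Ck_on_SucI[OF assms(1) has_derivative_mult[OF Ck_on_has_derivative[OF assms(1) Suc.prems(1)]
          Ck_on_has_derivative[OF assms(1) Suc.prems(2)]]]) (use deriv in simp_all)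
qed (simp add: continuous_on_mult)

lemma Ck_on_bounded_linear:
  assumes "open U" "bounded_linear L" "Ck_on k U f"
  shows "Ck_on k U (\<lambda>x. L (f x))"
  using assms(3)
proof (induction k arbitrary: f)
  case (Suc k)
  show ?case
    by (rule Ck_on_SucI[OF assms(1) bounded_linear.has_derivative[OF assms(2)
          Ck_on_has_derivative[OF assms(1) Suc.prems]]]) (use Suc in auto)
qed (use bounded_linear.continuous_on[OF assms(2)] in auto)

lemma Ck_on_compose_linear:
  assumes "open U" "open V" "bounded_linear L" "L ` V \<subseteq> U" "Ck_on k U f"
  shows "Ck_on k V (\<lambda>x. f (L x))"
  using assms(5)
proof (induction k arbitrary: f)
  case 0
  then show ?case
    using continuous_on_compose2[of U f V L] linear_continuous_on[OF assms(3)] assms(4) by auto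
next
  case (Suc k)
  have deriv: "((\<lambda>x. f (L x)) has_derivative (\<lambda>v. frechet_derivative f (at (L x)) (L v))) (at x)"
    if "x \<in> V" for x
    using that assms(4)
    by (intro has_derivative_compose[OF bounded_linear_imp_has_derivative[OF assms(3)]]
        Ck_on_has_derivative[OF assms(1) Suc.prems]) auto
  show ?case
    by (rule Ck_on_SucI[OF assms(2) deriv]) (use Suc in auto)
qed

lemma Ck_on_linear:
  assumes "open U" "bounded_linear L"
  shows "Ck_on k U L"
proof (cases k)
  case (Suc j)
  show ?thesis
    unfolding Suc using bounded_linear_imp_has_derivative[OF assms(2)]
    by (rule Ck_on_SucI[OF assms(1)]) (simp_all add: Ck_on_const[OF assms(1)])
qed (use linear_continuous_on[OF assms(2)] in auto)

lemma smooth_on_cong: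
  "\<lbrakk>open U; smooth_on U f; \<And>x. x \<in> U \<Longrightarrow> f x = g x\<rbrakk> \<Longrightarrow> smooth_on U g"
  unfolding smooth_on_def using Ck_on_cong by metis

lemma smooth_on_const: "open U \<Longrightarrow> smooth_on U (\<lambda>_. a)"
  by (simp add: smooth_on_def Ck_on_const)

lemma smooth_on_add:
  "\<lbrakk>open U; smooth_on U f; smooth_on U g\<rbrakk> \<Longrightarrow> smooth_on U (\<lambda>x. f x + g x)"
  by (simp add: smooth_on_def Ck_on_add)

lemma smooth_on_mult:
  fixes f g :: "'a::euclidean_space \<Rightarrow> real"
  shows "\<lbrakk>open U; smooth_on U f; smooth_on U g\<rbrakk> \<Longrightarrow> smooth_on U (\<lambda>x. f x * g x)"
  by (simp add: smooth_on_def Ck_on_mult)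

lemma smooth_on_bounded_linear:
  "\<lbrakk>open U; bounded_linear L; smooth_on U f\<rbrakk> \<Longrightarrow> smooth_on U (\<lambda>x. L (f x))"
  by (simp add: smooth_on_def Ck_on_bounded_linear)

lemma smooth_on_compose_linear:
  "\<lbrakk>open U; open V; bounded_linear L; L ` V \<subseteq> U; smooth_on U f\<rbrakk> \<Longrightarrow> smooth_on V (\<lambda>x. f (L x))"
  by (simp add: smooth_on_def Ck_on_compose_linear)

lemma smooth_on_linear: "\<lbrakk>open U; bounded_linear L\<rbrakk> \<Longrightarrow> smooth_on U L"
  by (simp add: smooth_on_def Ck_on_linear)

lemma smooth_on_directional_derivative:
  "smooth_on U f \<Longrightarrow> smooth_on U (\<lambda>x. frechet_derivative f (at x) v)"
  unfolding smooth_on_def by (metis Ck_on.simps(2))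

lemma smooth_on_has_derivative:
  "\<lbrakk>open U; smooth_on U f; x \<in> U\<rbrakk> \<Longrightarrow> (f has_derivative frechet_derivative f (at x)) (at x)"
  unfolding smooth_on_def using Ck_on_has_derivative by blast

section \<open>Calculus in a bundle chart\<close>

text \<open>One fixed bundle chart, where the symmetry condition and the Jacobi equation are both stated.\<close>

locale bundle_chart =
  fixes A :: "('p, 'e, 'n::finite, 'm::finite) alg"
    and c :: "('p, 'e, 'n, 'm) bchart"
  assumes algebroid: "lie_algebroid A"
    and chart: "c \<in> atlas A"
begin

abbreviation region :: "'e set" where
  "region \<equiv> edom A c \<inter> nonzero A"

abbreviation coord :: "'e \<Rightarrow> (real ^ 'n) \<times> (real ^ 'm)" where
  "coord \<equiv> snd (echart A c)"

abbreviation point :: "(real ^ 'n) \<times> (real ^ 'm) \<Rightarrow> 'e" where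
  "point \<equiv> chart_inv (echart A c)"

lemma vector_bundle_A: "vector_bundle A"
  using algebroid by (simp add: lie_algebroid_def)

lemma cdom_subset: "cdom c \<subseteq> topspace (base A)"
  using vector_bundle_A chart unfolding vector_bundle_def by blast

lemma open_base_image: "open (xc c ` cdom c)"
  using vector_bundle_A chart unfolding vector_bundle_def by blast

lemma inj_on_base: "inj_on (xc c) (cdom c)"
proof -
  have "homeomorphic_map (subtopology (base A) (cdom c)) (top_of_set (xc c ` cdom c)) (xc c)"
    using vector_bundle_A chart unfolding vector_bundle_def by blast
  then have "inj_on (xc c) (topspace (subtopology (base A) (cdom c)))"
    by (rule homeomorphic_imp_injective_map)
  then show ?thesis
    using cdom_subset by (simp add: Int_absorb1)
qed

lemma
  assumes "p \<in> cdom c"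
  shows bij_fibre: "bij_betw (yc c) (fibre A p) UNIV"
    and yc_vzero: "yc c (vzero A p) = 0"
    and yc_vadd: "\<lbrakk>e \<in> fibre A p; e' \<in> fibre A p\<rbrakk> \<Longrightarrow> yc c (vadd A e e') = yc c e + yc c e'"
    and yc_vscale: "e \<in> fibre A p \<Longrightarrow> yc c (vscale A r e) = r *\<^sub>R yc c e"
  using vector_bundle_A chart assms unfolding vector_bundle_def by blast+

lemma
  assumes "p \<in> cdom c"
  shows vzero_fibre: "vzero A p \<in> fibre A p"
    and vadd_fibre: "\<lbrakk>e \<in> fibre A p; e' \<in> fibre A p\<rbrakk> \<Longrightarrow> vadd A e e' \<in> fibre A p"
    and vscale_fibre: "e \<in> fibre A p \<Longrightarrow> vscale A r e \<in> fibre A p"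
  using vector_bundle_A cdom_subset assms unfolding vector_bundle_def by blast+

lemma yc_inj: "\<lbrakk>p \<in> cdom c; e \<in> fibre A p; e' \<in> fibre A p; yc c e = yc c e'\<rbrakk> \<Longrightarrow> e = e'"
  using bij_fibre by (metis bij_betw_imp_inj_on inj_onD)

definition fibre_vec :: "'p \<Rightarrow> real ^ 'm \<Rightarrow> 'e" where
  "fibre_vec p a = inv_into (fibre A p) (yc c) a"

lemma yc_fibre_vec: "p \<in> cdom c \<Longrightarrow> yc c (fibre_vec p a) = a"
  and fibre_vec_fibre: "p \<in> cdom c \<Longrightarrow> fibre_vec p a \<in> fibre A p"
  using bij_fibre[of p] unfolding fibre_vec_def
  by (auto simp: bij_betw_def intro: f_inv_into_f inv_into_into)

lemma fibre_vec_yc: "\<lbrakk>p \<in> cdom c; e \<in> fibre A p\<rbrakk> \<Longrightarrow> fibre_vec p (yc c e) = e"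
  using yc_inj yc_fibre_vec fibre_vec_fibre by blast

lemma fibre_vec_add:
  "p \<in> cdom c \<Longrightarrow> fibre_vec p (a + b) = vadd A (fibre_vec p a) (fibre_vec p b)"
  by (rule yc_inj[of p]) (simp_all add: vadd_fibre fibre_vec_fibre yc_fibre_vec yc_vadd)

lemma fibre_vec_scale:
  "p \<in> cdom c \<Longrightarrow> fibre_vec p (r *\<^sub>R a) = vscale A r (fibre_vec p a)"
  by (rule yc_inj[of p]) (simp_all add: vscale_fibre fibre_vec_fibre yc_fibre_vec yc_vscale)

lemma fibre_vec_zero: "p \<in> cdom c \<Longrightarrow> fibre_vec p 0 = vzero A p"
  by (rule yc_inj[of p]) (simp_all add: vzero_fibre fibre_vec_fibre yc_fibre_vec yc_vzero)

lemma proj_fibre_vec: "p \<in> cdom c \<Longrightarrow> proj A (fibre_vec p a) = p"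
  using fibre_vec_fibre by (auto simp: fibre_def)

lemma frame_eq_fibre_vec: "frame A c \<alpha> p = fibre_vec p (axis \<alpha> 1)"
  by (simp add: frame_def fibre_vec_def)

lemma coord_eq: "coord w = (xc c (proj A w), yc c w)"
  by (simp add: echart_def)

lemma point_coord: "w \<in> edom A c \<Longrightarrow> point (coord w) = w"
proof -
  have "inj_on coord (edom A c)"
    using inj_on_base yc_inj
    by (auto simp: inj_on_def coord_eq edom_def fibre_def)
  then have "inv_into (edom A c) coord (coord w) = w" if "w \<in> edom A c"
    using that by (rule inv_into_f_f)
  then show "w \<in> edom A c \<Longrightarrow> point (coord w) = w"
    by (simp add: chart_inv_def echart_def)
qed

lemma region_proj: "w \<in> region \<Longrightarrow> proj A w \<in> cdom c"
  by (simp add: edom_def)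

text \<open>The zero section corresponds to \<open>y = 0\<close>, so the coordinate image of the region is a product of
  open sets. Its openness is what makes functions that are smooth on the region smooth near each
  of its points.\<close>

lemma coord_image_region: "coord ` region = (xc c ` cdom c) \<times> (UNIV - {0})"
proof (intro equalityI subsetI)
  fix z assume "z \<in> coord ` region"
  then obtain w where w: "w \<in> region" "z = coord w" by blast
  have "yc c w \<noteq> 0"
    using w(1) yc_inj[OF region_proj[OF w(1)] _ vzero_fibre[OF region_proj[OF w(1)]], of w]
      yc_vzero[OF region_proj[OF w(1)]]
    by (auto simp: nonzero_def fibre_def)
  then show "z \<in> (xc c ` cdom c) \<times> (UNIV - {0})"
    using w by (auto simp: coord_eq edom_def)
next
  fix z assume "z \<in> (xc c ` cdom c) \<times> (UNIV - {0 :: real ^ 'm})"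
  then obtain p a where z: "z = (xc c p, a)" "p \<in> cdom c" "a \<noteq> 0" by auto
  let ?w = "fibre_vec p a"
  have "?w \<noteq> vzero A p"
    using z yc_fibre_vec yc_vzero by metis
  then have "?w \<in> region"
    using z cdom_subset by (auto simp: edom_def nonzero_def proj_fibre_vec)
  moreover have "coord ?w = z"
    using z by (simp add: coord_eq proj_fibre_vec yc_fibre_vec)
  ultimately show "z \<in> coord ` region"
    by blast
qed

lemma open_coord_region: "open (coord ` region)"
  unfolding coord_image_region by (intro open_Times open_base_image open_delete open_UNIV)

definition chart_smooth :: "('e \<Rightarrow> real) \<Rightarrow> bool" where
  "chart_smooth f \<longleftrightarrow> smooth_on (coord ` region) (f \<circ> point)"

lemma chart_smooth_cong:
  assumes "chart_smooth f" "\<And>w. w \<in> region \<Longrightarrow> f w = g w"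
  shows "chart_smooth g"
  using assms(1) unfolding chart_smooth_def
  by (rule smooth_on_cong[OF open_coord_region]) (auto simp: point_coord assms(2))

lemma chart_smooth_const: "chart_smooth (\<lambda>_. r)"
  using smooth_on_const[OF open_coord_region] by (simp add: chart_smooth_def comp_def)

lemma chart_smooth_add:
  "\<lbrakk>chart_smooth f; chart_smooth g\<rbrakk> \<Longrightarrow> chart_smooth (\<lambda>w. f w + g w)"
  using smooth_on_add[OF open_coord_region] by (simp add: chart_smooth_def comp_def)

lemma chart_smooth_mult:
  "\<lbrakk>chart_smooth f; chart_smooth g\<rbrakk> \<Longrightarrow> chart_smooth (\<lambda>w. f w * g w)"
  using smooth_on_mult[OF open_coord_region] by (simp add: chart_smooth_def comp_def)

lemma chart_smooth_sum:
  "(\<And>i. i \<in> I \<Longrightarrow> chart_smooth (f i)) \<Longrightarrow> chart_smooth (\<lambda>w. \<Sum>i\<in>I. f i w)"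
  by (induction I rule: infinite_finite_induct) (auto intro: chart_smooth_const chart_smooth_add)

lemma chart_smooth_component:
  assumes "smooth_on (coord ` region) (F \<circ> point)"
  shows "chart_smooth (\<lambda>w. F w $ \<alpha>)"
  using smooth_on_bounded_linear[OF open_coord_region bounded_linear_vec_nth assms]
  by (simp add: chart_smooth_def comp_def)

text \<open>In the coordinates of the total space, a pullback from the base is a function of the first
  factor; hence the anchor and structure functions are smooth on the region.\<close>

lemma chart_smooth_pullback:
  assumes "smooth_on (xc c ` cdom c) (f \<circ> chart_inv (xchart c))"
  shows "chart_smooth (\<lambda>w. f (proj A w))"
proof -
  have "smooth_on (coord ` region) (\<lambda>z. (f \<circ> chart_inv (xchart c)) (fst z))"
    by (rule smooth_on_compose_linear[OF open_base_image open_coord_region bounded_linear_fst _ assms])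
      (auto simp: coord_image_region)
  then show ?thesis
    unfolding chart_smooth_def
  proof (rule smooth_on_cong[OF open_coord_region])
    fix z assume "z \<in> coord ` region"
    then obtain w where w: "w \<in> region" "z = coord w"
      by blast
    have "chart_inv (xchart c) (xc c (proj A w)) = proj A w"
      using inj_on_base region_proj[OF w(1)] by (simp add: chart_inv_def xchart_def)
    then show "(f \<circ> chart_inv (xchart c)) (fst z) = ((\<lambda>w. f (proj A w)) \<circ> point) z"
      using w by (simp add: point_coord) (simp add: coord_eq)
  qed
qed

lemma chart_smooth_linear:
  assumes "bounded_linear L"
  shows "chart_smooth (\<lambda>w. L (coord w))"
  unfolding chart_smooth_def
  by (rule smooth_on_cong[OF open_coord_region smooth_on_linear[OF open_coord_region assms]])
    (auto simp: point_coord)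

abbreviation ddir :: "'e \<Rightarrow> (real ^ 'n) \<times> (real ^ 'm) \<Rightarrow> 'e tangent" where
  "ddir \<equiv> dir_deriv (echart A c)"

lemma smooth_near_region: "\<lbrakk>chart_smooth f; w \<in> region\<rbrakk> \<Longrightarrow> smooth_near (echart A c) w f"
  unfolding smooth_near_def chart_smooth_def using open_coord_region
  by (intro exI[of _ "coord ` region"]) (auto simp: echart_def)

lemma ddir_eq:
  "\<lbrakk>chart_smooth f; w \<in> region\<rbrakk> \<Longrightarrow> ddir w \<xi> f = frechet_derivative (f \<circ> point) (at (coord w)) \<xi>"
  by (simp add: dir_deriv_def smooth_near_region)

text \<open>On functions that are not smooth near \<open>w\<close> the functional is constantly \<open>0\<close>, which is linear
  in the direction as well.\<close>

lemma linear_ddir: "linear (\<lambda>\<xi>. ddir w \<xi> f)"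
proof (cases "smooth_near (echart A c) w f")
  case True
  then have "((f \<circ> point) has_derivative frechet_derivative (f \<circ> point) (at (coord w))) (at (coord w))"
    using smooth_on_has_derivative unfolding smooth_near_def by blast
  then show ?thesis
    using True by (simp add: dir_deriv_def has_derivative_linear)
qed (simp add: dir_deriv_def linear_zero)

lemma has_derivative_ddir:
  assumes "chart_smooth f" "w \<in> region"
  shows "((f \<circ> point) has_derivative (\<lambda>\<xi>. ddir w \<xi> f)) (at (coord w))"
  unfolding ddir_eq[OF assms]
  by (rule smooth_on_has_derivative[OF open_coord_region])
    (use assms in \<open>simp_all add: chart_smooth_def\<close>)

lemma ddirI:
  assumes "chart_smooth f" "w \<in> region" "((f \<circ> point) has_derivative f') (at (coord w))"
  shows "ddir w \<xi> f = f' \<xi>"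
  using has_derivative_unique[OF has_derivative_ddir[OF assms(1,2)] assms(3)] by metis

lemma ddir_cong:
  assumes "chart_smooth f" "w \<in> region" "\<And>w. w \<in> region \<Longrightarrow> f w = g w"
  shows "ddir w \<xi> f = ddir w \<xi> g"
proof -
  have "frechet_derivative (f \<circ> point) (at (coord w)) = frechet_derivative (g \<circ> point) (at (coord w))"
    using assms(2,3) by (intro frechet_derivative_cong_open[OF open_coord_region]) (auto simp: point_coord)
  then show ?thesis
    using ddir_eq[OF assms(1,2)] ddir_eq[OF chart_smooth_cong[OF assms(1,3)] assms(2)] by simp
qed

lemma ddir_add:
  assumes "chart_smooth f" "chart_smooth g" "w \<in> region"
  shows "ddir w \<xi> (\<lambda>w. f w + g w) = ddir w \<xi> f + ddir w \<xi> g"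
  using has_derivative_add[OF has_derivative_ddir[OF assms(1,3)] has_derivative_ddir[OF assms(2,3)]]
  by (intro ddirI chart_smooth_add assms) (simp add: comp_def)

lemma ddir_scale:
  assumes "chart_smooth f" "w \<in> region"
  shows "ddir w \<xi> (\<lambda>w. r * f w) = r * ddir w \<xi> f"
  using has_derivative_mult_right[OF has_derivative_ddir[OF assms]]
  by (intro ddirI chart_smooth_mult chart_smooth_const assms) (simp add: comp_def)

lemma ddir_linear:
  assumes "bounded_linear L" "w \<in> region"
  shows "ddir w \<xi> (\<lambda>w. L (coord w)) = L \<xi>"
proof (rule ddirI[OF chart_smooth_linear[OF assms(1)] assms(2)])
  show "((\<lambda>w. L (coord w)) \<circ> point has_derivative L) (at (coord w))"
    using assms
    by (intro has_derivative_transform_within_open[OF bounded_linear_imp_has_derivative[OF assms(1)]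
      open_coord_region]) (auto simp: point_coord)
qed

lemma ddir_x: "w \<in> region \<Longrightarrow> ddir w \<xi> (\<lambda>w. xc c (proj A w) $ i) = fst \<xi> $ i"
  using ddir_linear[of "\<lambda>z. fst z $ i"]
  by (simp add: coord_eq bounded_linear_compose[OF bounded_linear_vec_nth bounded_linear_fst])

lemma ddir_y: "w \<in> region \<Longrightarrow> ddir w \<xi> (\<lambda>w. yc c w $ \<alpha>) = snd \<xi> $ \<alpha>"
  using ddir_linear[of "\<lambda>z. snd z $ \<alpha>"]
  by (simp add: coord_eq bounded_linear_compose[OF bounded_linear_vec_nth bounded_linear_snd])

lemma chart_smooth_y: "chart_smooth (\<lambda>w. yc c w $ \<alpha>)"
  using chart_smooth_linear[of "\<lambda>z. snd z $ \<alpha>"]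
  by (simp add: coord_eq bounded_linear_compose[OF bounded_linear_vec_nth bounded_linear_snd])

lemma chart_smooth_ddir: "chart_smooth f \<Longrightarrow> chart_smooth (\<lambda>w. ddir w \<xi> f)"
  unfolding chart_smooth_def[of "\<lambda>w. ddir w \<xi> f"]
  by (rule smooth_on_cong[OF open_coord_region smooth_on_directional_derivative[of _ "f \<circ> point" \<xi>]])
    (auto simp: ddir_eq point_coord chart_smooth_def[symmetric])

section \<open>Coefficients of sections of the prolongation\<close>

lemma anchor_coeff_smooth: "chart_smooth (\<lambda>w. anchor_coeff A c \<alpha> i (proj A w))"
  using algebroid chart unfolding lie_algebroid_def is_anchor_def
  by (intro chart_smooth_pullback) blast

lemma frame_smooth_section: "smooth_section_on A (cdom c) (frame A c \<alpha>)"
proof -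
  have "smooth_on (xc d ` (cdom c \<inter> cdom d)) (yc d \<circ> frame A c \<alpha> \<circ> chart_inv (xchart d))"
    if "d \<in> atlas A" for d
    using vector_bundle_A chart that unfolding vector_bundle_def by blast
  then show ?thesis
    by (simp add: smooth_section_on_def frame_eq_fibre_vec fibre_vec_fibre)
qed

lemma openin_cdom: "openin (base A) (cdom c)"
  using vector_bundle_A chart unfolding vector_bundle_def by blast

lemma bracket_frame_smooth_section:
  "smooth_section_on A (cdom c) (bracket A (cdom c) (frame A c \<alpha>) (frame A c \<beta>))"
proof -
  have "\<forall>V s t. openin (base A) V \<and> smooth_section_on A V s \<and> smooth_section_on A V t \<longrightarrow>
      smooth_section_on A V (bracket A V s t)"
    using algebroid unfolding lie_algebroid_def is_lie_bracket_def by (elim conjE)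
  then show ?thesis
    using openin_cdom frame_smooth_section by simp
qed

lemma struct_fun_smooth: "chart_smooth (\<lambda>w. struct_fun A c \<alpha> \<beta> \<gamma> (proj A w))"
proof (rule chart_smooth_pullback)
  have "smooth_on (xc c ` cdom c)
      (yc c \<circ> bracket A (cdom c) (frame A c \<alpha>) (frame A c \<beta>) \<circ> chart_inv (xchart c))"
    using bracket_frame_smooth_section chart unfolding smooth_section_on_def by fastforce
  from smooth_on_bounded_linear[OF open_base_image bounded_linear_vec_nth this]
  show "smooth_on (xc c ` cdom c) (struct_fun A c \<alpha> \<beta> \<gamma> \<circ> chart_inv (xchart c))"
    by (simp add: struct_fun_def comp_def)
qed

lemma struct_fun_antisym:
  assumes "p \<in> cdom c"
  shows "struct_fun A c \<alpha> \<beta> \<gamma> p = - struct_fun A c \<beta> \<alpha> \<gamma> p"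
proof -
  let ?b = "\<lambda>\<alpha> \<beta>. bracket A (cdom c) (frame A c \<alpha>) (frame A c \<beta>)"
  have "\<forall>V s t u r. openin (base A) V \<and>
        smooth_section_on A V s \<and> smooth_section_on A V t \<and> smooth_section_on A V u \<longrightarrow>
        (\<forall>p\<in>V. bracket A V (sec_add A s t) u p =
                  vadd A (bracket A V s u p) (bracket A V t u p) \<and>
                bracket A V (sec_scale A (\<lambda>_. r) s) u p = vscale A r (bracket A V s u p) \<and>
                bracket A V s t p = vscale A (- 1) (bracket A V t s p) \<and>
                vadd A (bracket A V s (bracket A V t u) p)
                  (vadd A (bracket A V t (bracket A V u s) p)
                          (bracket A V u (bracket A V s t) p)) = vzero A p)"
    using algebroid unfolding lie_algebroid_def is_lie_bracket_def by (elim conjE)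
  from this[rule_format, of "cdom c" "frame A c \<alpha>" "frame A c \<beta>" "frame A c \<alpha>" p]
  have "?b \<alpha> \<beta> p = vscale A (- 1) (?b \<beta> \<alpha> p)"
    using openin_cdom frame_smooth_section assms by simp
  moreover have "?b \<beta> \<alpha> p \<in> fibre A p"
    using bracket_frame_smooth_section assms unfolding smooth_section_on_def by blast
  ultimately show ?thesis
    using assms by (simp add: struct_fun_def yc_vscale)
qed

lemma anchor_fibre_vec:
  assumes p: "p \<in> cdom c"
  shows "anchor A (fibre_vec p a) f = (\<Sum>\<alpha>\<in>UNIV. a $ \<alpha> * anchor A (frame A c \<alpha> p) f)"
proof -
  have "anchor A (fibre_vec p (u + v)) f = anchor A (fibre_vec p u) f + anchor A (fibre_vec p v) f" for u v
    using algebroid cdom_subset p fibre_vec_fibre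
    unfolding lie_algebroid_def is_anchor_def fibre_vec_add[OF p] by blast
  moreover have "anchor A (fibre_vec p (r *\<^sub>R u)) f = r * anchor A (fibre_vec p u) f" for r u
    using algebroid cdom_subset p fibre_vec_fibre
    unfolding lie_algebroid_def is_anchor_def fibre_vec_scale[OF p] by blast
  ultimately have lin: "linear (\<lambda>a. anchor A (fibre_vec p a) f)"
    by (intro linearI) auto
  have "a = (\<Sum>\<alpha>\<in>UNIV. a $ \<alpha> *\<^sub>R axis \<alpha> 1)"
    by (simp add: vec_eq_iff axis_def if_distrib cong: if_cong)
  then have "anchor A (fibre_vec p a) f = anchor A (fibre_vec p (\<Sum>\<alpha>\<in>UNIV. a $ \<alpha> *\<^sub>R axis \<alpha> 1)) f"
    by simp
  also have "\<dots> = (\<Sum>\<alpha>\<in>UNIV. a $ \<alpha> * anchor A (fibre_vec p (axis \<alpha> 1)) f)"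
    by (simp add: linear_sum[OF lin] linear_scale[OF lin])
  finally show ?thesis
    by (simp add: frame_eq_fibre_vec)
qed

definition anchor_vec :: "real ^ 'm \<Rightarrow> 'e \<Rightarrow> real ^ 'n" where
  "anchor_vec a w = (\<chi> i. \<Sum>\<alpha>\<in>UNIV. a $ \<alpha> * anchor_coeff A c \<alpha> i (proj A w))"

text \<open>The tangent part of a frame combination is a single directional derivative, so it inherits
  the calculus of directional derivatives.\<close>

lemma snd_frame_comb: "snd (frame_comb A c a b w) = ddir w (anchor_vec a w, b)"
proof
  fix f
  note lin = linear_ddir[of w f]
  have x: "anchor_vec a w = (\<Sum>\<alpha>\<in>UNIV. \<Sum>i\<in>UNIV. (a $ \<alpha> * anchor_coeff A c \<alpha> i (proj A w)) *\<^sub>R axis i 1)"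
    by (simp add: anchor_vec_def vec_eq_iff axis_def if_distrib cong: if_cong)
  have y: "b = (\<Sum>\<alpha>\<in>UNIV. b $ \<alpha> *\<^sub>R axis \<alpha> 1)"
    by (simp add: vec_eq_iff axis_def if_distrib cong: if_cong)
  have "ddir w (anchor_vec a w, b) f = ddir w (anchor_vec a w, 0) f + ddir w (0, b) f"
    using linear_add[OF lin, of "(anchor_vec a w, 0)" "(0, b)"] by simp
  also have "(anchor_vec a w, 0) =
      (\<Sum>\<alpha>\<in>UNIV. \<Sum>i\<in>UNIV. (a $ \<alpha> * anchor_coeff A c \<alpha> i (proj A w)) *\<^sub>R (axis i 1, 0 :: real ^ 'm))"
    by (subst x) (simp add: prod_eq_iff fst_sum snd_sum)
  also have "(0, b) = (\<Sum>\<alpha>\<in>UNIV. b $ \<alpha> *\<^sub>R (0 :: real ^ 'n, axis \<alpha> 1))"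
    by (subst y) (simp add: prod_eq_iff fst_sum snd_sum)
  finally show "snd (frame_comb A c a b w) f = ddir w (anchor_vec a w, b) f"
    by (simp add: linear_sum[OF lin] linear_scale[OF lin] frame_comb_def Xframe_def Vframe_def
        partial_x_def partial_y_def sum.distrib sum_distrib_left mult.assoc del: scaleR_Pair)
qed

lemma fst_frame_comb: "fst (frame_comb A c a b w) = fibre_vec (proj A w) a"
  by (simp add: frame_comb_def fibre_vec_def)

lemma frame_comb_add:
  "w \<in> region \<Longrightarrow> frame_comb A c (a + a') (b + b') w =
     (vadd A (fst (frame_comb A c a b w)) (fst (frame_comb A c a' b' w)),
      \<lambda>f. snd (frame_comb A c a b w) f + snd (frame_comb A c a' b' w) f)"
  by (auto simp: prod_eq_iff fst_frame_comb fibre_vec_add region_proj)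
    (auto simp: frame_comb_def algebra_simps sum.distrib)

lemma frame_comb_scale:
  "w \<in> region \<Longrightarrow> frame_comb A c (r *\<^sub>R a) (r *\<^sub>R b) w =
     (vscale A r (fst (frame_comb A c a b w)), \<lambda>f. r * snd (frame_comb A c a b w) f)"
  by (auto simp: prod_eq_iff fst_frame_comb fibre_vec_scale region_proj)
    (auto simp: frame_comb_def algebra_simps sum_distrib_left)

lemma yc_fst_frame_comb: "w \<in> region \<Longrightarrow> yc c (fst (frame_comb A c a b w)) = a"
  by (simp add: fst_frame_comb yc_fibre_vec region_proj)

lemma snd_frame_comb_y: "w \<in> region \<Longrightarrow> snd (frame_comb A c a b w) (\<lambda>e. yc c e $ \<gamma>) = b $ \<gamma>"
  by (simp add: snd_frame_comb ddir_y)

lemma frame_comb_eq_iff: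
  assumes "w \<in> region"
  shows "frame_comb A c a b w = frame_comb A c a' b' w \<longleftrightarrow> a = a' \<and> b = b'"
proof
  assume eq: "frame_comb A c a b w = frame_comb A c a' b' w"
  have "a = a'"
    using yc_fst_frame_comb[OF assms] eq by metis
  moreover have "b $ \<gamma> = b' $ \<gamma>" for \<gamma>
    using snd_frame_comb_y[OF assms] eq by metis
  ultimately show "a = a' \<and> b = b'"
    by (simp add: vec_eq_iff)
qed auto

lemma pzero_frame_comb: "w \<in> region \<Longrightarrow> pzero A w = frame_comb A c 0 0 w"
  by (simp add: pzero_def frame_comb_def fibre_vec_zero[symmetric] region_proj fibre_vec_def)

definition smooth_field :: "('e \<Rightarrow> real ^ 'm) \<Rightarrow> bool" where
  "smooth_field p \<longleftrightarrow> (\<forall>\<gamma>. chart_smooth (\<lambda>w. p w $ \<gamma>))"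

lemma smooth_fieldD: "smooth_field p \<Longrightarrow> chart_smooth (\<lambda>w. p w $ \<gamma>)"
  by (simp add: smooth_field_def)

lemma smooth_field_cong:
  "\<lbrakk>smooth_field p; \<And>w. w \<in> region \<Longrightarrow> p w = p' w\<rbrakk> \<Longrightarrow> smooth_field p'"
  unfolding smooth_field_def using chart_smooth_cong[of "\<lambda>w. p w $ _" "\<lambda>w. p' w $ _"] by auto

lemma smooth_field_zero: "smooth_field (\<lambda>_. 0)"
  by (simp add: smooth_field_def chart_smooth_const)

lemma smooth_field_add:
  "\<lbrakk>smooth_field p; smooth_field p'\<rbrakk> \<Longrightarrow> smooth_field (\<lambda>w. p w + p' w)"
  by (simp add: smooth_field_def chart_smooth_add)

lemma smooth_field_scale: "smooth_field p \<Longrightarrow> smooth_field (\<lambda>w. r *\<^sub>R p w)"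
  by (simp add: smooth_field_def chart_smooth_mult chart_smooth_const)

lemma smooth_field_diff:
  "\<lbrakk>smooth_field p; smooth_field p'\<rbrakk> \<Longrightarrow> smooth_field (\<lambda>w. p w - p' w)"
  using smooth_field_add[of p "\<lambda>w. - 1 *\<^sub>R p' w"] smooth_field_scale[of p' "- 1"] by simp

lemma smooth_field_matrix:
  fixes M :: "'e \<Rightarrow> real ^ 'm ^ 'm"
  assumes "\<And>\<gamma> \<beta>. chart_smooth (\<lambda>w. M w $ \<gamma> $ \<beta>)" "smooth_field p"
  shows "smooth_field (\<lambda>w. M w *v p w)"
  using assms by (simp add: smooth_field_def matrix_vector_mult_def chart_smooth_sum chart_smooth_mult)

lemma smooth_frame_comb_derivative:
  assumes "smooth_field p" "smooth_field q" "chart_smooth f"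
  shows "chart_smooth (\<lambda>w. snd (frame_comb A c (p w) (q w) w) f)"
  using assms
  by (auto simp: frame_comb_def Xframe_def Vframe_def partial_x_def partial_y_def smooth_field_def
      intro!: chart_smooth_sum chart_smooth_add chart_smooth_mult chart_smooth_ddir anchor_coeff_smooth)

text \<open>Smoothness of the coefficients is part of the relation, since applying a tangent vector to a
  coefficient gives its derivative only if the coefficient is smooth.\<close>

definition represents :: "'e psection \<Rightarrow> ('e \<Rightarrow> real ^ 'm) \<Rightarrow> ('e \<Rightarrow> real ^ 'm) \<Rightarrow> bool" where
  "represents Z p q \<longleftrightarrow> smooth_field p \<and> smooth_field q \<and>
     (\<forall>w\<in>region. Z w = frame_comb A c (p w) (q w) w)"

lemma representsD: "\<lbrakk>represents Z p q; w \<in> region\<rbrakk> \<Longrightarrow> Z w = frame_comb A c (p w) (q w) w"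
  by (simp add: represents_def)

lemma represents_cong:
  assumes "represents Z p q" "\<And>w. w \<in> region \<Longrightarrow> p w = p' w" "\<And>w. w \<in> region \<Longrightarrow> q w = q' w"
  shows "represents Z p' q'"
  using assms smooth_field_cong[of p p'] smooth_field_cong[of q q'] by (auto simp: represents_def)

lemma represents_Xcoeff: "\<lbrakk>represents Z p q; w \<in> region\<rbrakk> \<Longrightarrow> Xcoeff c Z w = p w"
  by (simp only: Xcoeff_def representsD yc_fst_frame_comb)

lemma represents_zero_iff:
  "\<lbrakk>represents Z p q; w \<in> region\<rbrakk> \<Longrightarrow> Z w = pzero A w \<longleftrightarrow> p w = 0 \<and> q w = 0"
  by (simp only: representsD pzero_frame_comb frame_comb_eq_iff)

lemma represents_Vcoeff: "\<lbrakk>represents Z p q; w \<in> region\<rbrakk> \<Longrightarrow> Vcoeff c Z w = q w"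
  by (simp only: Vcoeff_def representsD snd_frame_comb_y vec_lambda_eta)

lemma represents_add:
  "\<lbrakk>represents Y p q; represents Z p' q'\<rbrakk> \<Longrightarrow>
     represents (psec_add A Y Z) (\<lambda>w. p w + p' w) (\<lambda>w. q w + q' w)"
  unfolding represents_def by (simp add: frame_comb_add psec_add_def smooth_field_add)

lemma represents_scale:
  "represents Z p q \<Longrightarrow> represents (psec_scale A r Z) (\<lambda>w. r *\<^sub>R p w) (\<lambda>w. r *\<^sub>R q w)"
  unfolding represents_def by (simp add: frame_comb_scale psec_scale_def smooth_field_scale)

lemma represents_diff:
  assumes "represents Y p q" "represents Z p' q'"
  shows "represents (psec_diff A Y Z) (\<lambda>w. p w - p' w) (\<lambda>w. q w - q' w)"
  using represents_add[OF assms(1) represents_scale[OF assms(2), of "- 1"]] by (simp add: psec_diff_def)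

lemma represents_tangent_str:
  "represents Z p q \<Longrightarrow> represents (tangent_str A c Z) (\<lambda>_. 0) p"
  using represents_Xcoeff[of Z p q] smooth_field_zero
  by (auto simp: represents_def tangent_str_def)

text \<open>The bracket applies tangent vectors to coefficient functions that are known only on the region;
  the region being open, their values elsewhere do not matter.\<close>

lemma represents_derivative_cong:
  assumes "represents Z p q" "w \<in> region" "chart_smooth f" "\<And>w. w \<in> region \<Longrightarrow> f w = g w"
  shows "snd (Z w) f = snd (Z w) g"
  using ddir_cong[OF assms(3,2,4)] by (simp only: representsD[OF assms(1,2)] snd_frame_comb)

lemma represents_derivative_add:
  assumes "represents Z p q" "w \<in> region" "chart_smooth f" "chart_smooth g"
  shows "snd (Z w) (\<lambda>w. f w + g w) = snd (Z w) f + snd (Z w) g"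
  using ddir_add[OF assms(3,4,2)] by (simp only: representsD[OF assms(1,2)] snd_frame_comb)

lemma represents_derivative_scale:
  assumes "represents Z p q" "w \<in> region" "chart_smooth f"
  shows "snd (Z w) (\<lambda>w. r * f w) = r * snd (Z w) f"
  using ddir_scale[OF assms(3,2)] by (simp only: representsD[OF assms(1,2)] snd_frame_comb)

end

section \<open>The canonical connection of a semispray\<close>

locale semispray_chart = bundle_chart A c
  for A :: "('p, 'e, 'n::finite, 'm::finite) alg" and c :: "('p, 'e, 'n, 'm) bchart" +
  fixes S :: "'e psection"
  assumes semispray: "semispray A S"
begin

lemma smooth_field_y: "smooth_field (yc c)"
  by (simp add: smooth_field_def chart_smooth_y)

lemma smooth_field_spray: "smooth_field (Vcoeff c S)"
  using semispray chart unfolding semispray_def smooth_psection_def smooth_field_def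
  by (blast intro: chart_smooth_component)

text \<open>The condition \<open>J S = \<C>\<close> fixes the fibre part of \<open>S\<close> to be \<open>y\<close>. Its tangent part has the
  form of a directional derivative. The \<open>x\<close> part of the direction is determined by the
  compatibility with the anchor in the prolongation, tested on the base coordinates, and the \<open>y\<close> part
  by testing on the fibre coordinates.\<close>

lemma represents_spray: "represents S (yc c) (Vcoeff c S)"
proof -
  have "S w = frame_comb A c (yc c w) (Vcoeff c S w) w" if w: "w \<in> region" for w
  proof -
    have "S w \<in> prolong_fibre A w"
      using semispray w unfolding semispray_def smooth_psection_def by blast
    then obtain \<xi> where u: "fst (S w) \<in> fibre A (proj A w)" and v: "snd (S w) = ddir w \<xi>"
      and anchor: "anchor A (fst (S w)) = (\<lambda>f. snd (S w) (f \<circ> proj A))"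
      using chart w unfolding prolong_fibre_def tangent_space_def by (force simp: echart_def)
    have "tangent_str A c S w = euler A c w"
      using semispray chart w unfolding semispray_def by blast
    then have y: "yc c (fst (S w)) = yc c w"
      by (simp add: tangent_str_def euler_def frame_comb_eq_iff[OF w] Xcoeff_def)
    then have fst_S: "fst (S w) = fibre_vec (proj A w) (yc c w)"
      using fibre_vec_yc[OF region_proj[OF w] u] by simp
    have "fst \<xi> $ i = anchor_vec (yc c w) w $ i" for i
    proof -
      have "fst \<xi> $ i = anchor A (fst (S w)) (\<lambda>p. xc c p $ i)"
        by (simp add: anchor v comp_def ddir_x[OF w])
      also have "\<dots> = anchor_vec (yc c w) w $ i"
        by (simp add: fst_S anchor_fibre_vec[OF region_proj[OF w]] anchor_vec_def anchor_coeff_def)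
      finally show ?thesis .
    qed
    moreover have "snd \<xi> $ \<gamma> = Vcoeff c S w $ \<gamma>" for \<gamma>
      by (simp add: Vcoeff_def v ddir_y[OF w])
    ultimately have \<xi>: "\<xi> = (anchor_vec (yc c w) w, Vcoeff c S w)"
      by (intro prod_eqI) (simp_all add: vec_eq_iff)
    show ?thesis
      by (rule prod_eqI) (simp_all add: fst_S v \<xi> fst_frame_comb snd_frame_comb)
  qed
  then show ?thesis
    by (simp add: represents_def smooth_field_y smooth_field_spray)
qed

definition spray_deriv :: "('e \<Rightarrow> real ^ 'm) \<Rightarrow> 'e \<Rightarrow> real ^ 'm" where
  "spray_deriv p w = (\<chi> \<gamma>. snd (S w) (\<lambda>e. p e $ \<gamma>))"

text \<open>These are the matrices \<open>G\<close>, \<open>R\<close>, \<open>\<Lambda>\<close> and \<open>B\<close> of the introduction.\<close>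

definition fibre_jacobian :: "'e \<Rightarrow> real ^ 'm ^ 'm" where
  "fibre_jacobian w = (\<chi> \<gamma> \<beta>. snd (Vframe A c \<beta> w) (\<lambda>e. Vcoeff c S e $ \<gamma>))"

definition base_jacobian :: "'e \<Rightarrow> real ^ 'm ^ 'm" where
  "base_jacobian w = (\<chi> \<gamma> \<alpha>. snd (Xframe A c \<alpha> w) (\<lambda>e. Vcoeff c S e $ \<gamma>))"

definition spray_struct :: "'e \<Rightarrow> real ^ 'm ^ 'm" where
  "spray_struct w = (\<chi> \<gamma> \<beta>. \<Sum>\<alpha>\<in>UNIV. struct_fun A c \<alpha> \<beta> \<gamma> (proj A w) * yc c w $ \<alpha>)"

definition conn_matrix :: "'e \<Rightarrow> real ^ 'm ^ 'm" where
  "conn_matrix w = (1/2) *\<^sub>R (fibre_jacobian w + spray_struct w)"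

lemma smooth_field_spray_deriv:
  assumes "smooth_field p"
  shows "smooth_field (spray_deriv p)"
  unfolding smooth_field_def spray_deriv_def vec_lambda_beta
proof
  fix \<gamma>
  show "chart_smooth (\<lambda>w. snd (S w) (\<lambda>e. p e $ \<gamma>))"
    by (rule chart_smooth_cong[OF smooth_frame_comb_derivative[OF smooth_field_y smooth_field_spray
            smooth_fieldD[OF assms]]]) (simp only: representsD[OF represents_spray])
qed

lemma smooth_fibre_jacobian: "chart_smooth (\<lambda>w. fibre_jacobian w $ \<gamma> $ \<beta>)"
  by (simp add: fibre_jacobian_def Vframe_def partial_y_def chart_smooth_ddir
      smooth_fieldD[OF smooth_field_spray])

lemma smooth_base_jacobian: "chart_smooth (\<lambda>w. base_jacobian w $ \<gamma> $ \<beta>)"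
  by (simp add: base_jacobian_def Xframe_def partial_x_def chart_smooth_ddir chart_smooth_sum
      chart_smooth_mult anchor_coeff_smooth smooth_fieldD[OF smooth_field_spray])

lemma smooth_spray_struct: "chart_smooth (\<lambda>w. spray_struct w $ \<gamma> $ \<beta>)"
  by (simp add: spray_struct_def chart_smooth_sum chart_smooth_mult struct_fun_smooth chart_smooth_y)

lemma smooth_conn_matrix: "chart_smooth (\<lambda>w. conn_matrix w $ \<gamma> $ \<beta>)"
  unfolding conn_matrix_def vector_scaleR_component vector_add_component real_scaleR_def
  by (intro chart_smooth_mult chart_smooth_const chart_smooth_add smooth_fibre_jacobian smooth_spray_struct)

lemmas smooth_field_intros = smooth_field_zero smooth_field_add smooth_field_diff smooth_field_scale
  smooth_field_spray_deriv smooth_field_matrix smooth_fibre_jacobian smooth_base_jacobian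
  smooth_spray_struct smooth_conn_matrix

lemma spray_deriv_cong:
  assumes "smooth_field p" "\<And>w. w \<in> region \<Longrightarrow> p w = p' w" "w \<in> region"
  shows "spray_deriv p w = spray_deriv p' w"
  using represents_derivative_cong[OF represents_spray assms(3) smooth_fieldD[OF assms(1)]] assms(2)
  by (simp add: spray_deriv_def vec_eq_iff)

lemma spray_deriv_add:
  assumes "smooth_field p" "smooth_field p'" "w \<in> region"
  shows "spray_deriv (\<lambda>w. p w + p' w) w = spray_deriv p w + spray_deriv p' w"
  using represents_derivative_add[OF represents_spray assms(3) smooth_fieldD[OF assms(1)] smooth_fieldD[OF assms(2)]]
  by (simp add: spray_deriv_def vec_eq_iff)

lemma spray_deriv_scale:
  assumes "smooth_field p" "w \<in> region"
  shows "spray_deriv (\<lambda>w. r *\<^sub>R p w) w = r *\<^sub>R spray_deriv p w"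
  using represents_derivative_scale[OF represents_spray assms(2) smooth_fieldD[OF assms(1)]]
  by (simp add: spray_deriv_def vec_eq_iff)

lemma spray_deriv_diff:
  assumes "smooth_field p" "smooth_field p'" "w \<in> region"
  shows "spray_deriv (\<lambda>w. p w - p' w) w = spray_deriv p w - spray_deriv p' w"
  using spray_deriv_add[OF assms(1) smooth_field_scale[OF assms(2), of "- 1"] assms(3)]
    spray_deriv_scale[OF assms(2,3), of "- 1"] by simp

lemma spray_deriv_zero: "w \<in> region \<Longrightarrow> spray_deriv (\<lambda>_. 0) w = 0"
  using spray_deriv_scale[OF smooth_field_zero, of w 0] by simp

text \<open>The coefficients of \<open>S\<close> are the fibre coordinates and \<open>s\<close>: a section \<open>(p, q)\<close> differentiates
  the former to \<open>q\<close> and the latter to \<open>R p + G q\<close>.\<close>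

lemma represents_pbracket:
  assumes Z: "represents Z p q"
  shows "represents (pbracket A c S Z)
     (\<lambda>w. spray_deriv p w - q w + spray_struct w *v p w)
     (\<lambda>w. spray_deriv q w - base_jacobian w *v p w - fibre_jacobian w *v q w)"
proof -
  have smooth: "smooth_field p" "smooth_field q"
    using Z by (auto simp: represents_def)
  have "pbracket A c S Z w = frame_comb A c (spray_deriv p w - q w + spray_struct w *v p w)
     (spray_deriv q w - base_jacobian w *v p w - fibre_jacobian w *v q w) w" if w: "w \<in> region" for w
  proof -
    have DX: "snd (S w) (\<lambda>e. Xcoeff c Z e $ \<gamma>) = spray_deriv p w $ \<gamma>" for \<gamma>
      using represents_derivative_cong[OF represents_spray w smooth_fieldD[OF smooth(1)],
          of \<gamma> "\<lambda>e. Xcoeff c Z e $ \<gamma>"] represents_Xcoeff[OF Z] by (simp add: spray_deriv_def)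
    have DV: "snd (S w) (\<lambda>e. Vcoeff c Z e $ \<gamma>) = spray_deriv q w $ \<gamma>" for \<gamma>
      using represents_derivative_cong[OF represents_spray w smooth_fieldD[OF smooth(2)],
          of \<gamma> "\<lambda>e. Vcoeff c Z e $ \<gamma>"] represents_Vcoeff[OF Z] by (simp add: spray_deriv_def)
    have ZX: "snd (Z w) (\<lambda>e. Xcoeff c S e $ \<gamma>) = q w $ \<gamma>" for \<gamma>
      using represents_derivative_cong[OF Z w chart_smooth_y, of \<gamma> "\<lambda>e. Xcoeff c S e $ \<gamma>"]
        represents_Xcoeff[OF represents_spray] representsD[OF Z w] snd_frame_comb_y[OF w] by simp
    have ZV: "snd (Z w) (\<lambda>e. Vcoeff c S e $ \<gamma>) =
        (base_jacobian w *v p w) $ \<gamma> + (fibre_jacobian w *v q w) $ \<gamma>" for \<gamma>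
      by (simp add: representsD[OF Z w] frame_comb_def base_jacobian_def fibre_jacobian_def
          matrix_vector_mult_def sum.distrib mult.commute)
    have struct: "(\<Sum>\<alpha>\<in>UNIV. \<Sum>\<beta>\<in>UNIV. struct_fun A c \<alpha> \<beta> \<gamma> (proj A w) * Xcoeff c S w $ \<alpha> * Xcoeff c Z w $ \<beta>)
        = (spray_struct w *v p w) $ \<gamma>" for \<gamma>
      by (subst sum.swap) (simp add: represents_Xcoeff[OF Z w] represents_Xcoeff[OF represents_spray w]
          spray_struct_def matrix_vector_mult_def sum_distrib_right)
    show ?thesis
      unfolding pbracket_def frame_comb_eq_iff[OF w] DX DV ZX ZV struct
      by (simp add: vec_eq_iff)
  qed
  then show ?thesis
    using smooth by (auto simp: represents_def intro!: smooth_field_intros)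
qed

text \<open>Rewriting \<open>G\<close> as \<open>2 B - \<Lambda>\<close> leaves \<open>B\<close> and \<open>\<Lambda>\<close> as the only matrices in the connection terms,
  so the identities below hold by linearity alone.\<close>

lemma conn_matrix_mult: "fibre_jacobian w *v a = 2 *\<^sub>R (conn_matrix w *v a) - spray_struct w *v a"
  by (simp add: conn_matrix_def matrix_vector_mult_add_rdistrib scaleR_matrix_vector_assoc[symmetric])

lemma represents_canon_conn:
  assumes "represents Z p q"
  shows "represents (canon_conn A c S Z) p (\<lambda>w. 2 *\<^sub>R (conn_matrix w *v p w) - q w)"
  unfolding canon_conn_def lie_deriv_tensor_def
  by (rule represents_cong[OF represents_scale[OF represents_diff[OF
          represents_pbracket[OF represents_tangent_str[OF assms]]
          represents_tangent_str[OF represents_pbracket[OF assms]]], of "- 1"]])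
    (simp_all add: spray_deriv_zero conn_matrix_mult)

lemma represents_hproj:
  assumes "represents Z p q"
  shows "represents (hproj A c S Z) p (\<lambda>w. conn_matrix w *v p w)"
  unfolding hproj_def
  by (rule represents_cong[OF represents_scale[OF represents_add[OF assms represents_canon_conn[OF assms]]]])
    (simp_all add: scaleR_2[symmetric])

lemma represents_vproj:
  assumes "represents Z p q"
  shows "represents (vproj A c S Z) (\<lambda>_. 0) (\<lambda>w. q w - conn_matrix w *v p w)"
  unfolding vproj_def
  by (rule represents_cong[OF represents_scale[OF represents_diff[OF assms represents_canon_conn[OF assms]]]])
    (simp_all add: vec_eq_iff algebra_simps)

text \<open>The horizontal projection of a vertical section vanishes, so only the vertical half of the
  dynamical covariant derivative contributes, and its value is vertical again.\<close>

lemma represents_dyn_deriv_vertical: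
  assumes "represents Z (\<lambda>_. 0) q"
  shows "represents (dyn_deriv A c S Z) (\<lambda>_. 0)
     (\<lambda>w. spray_deriv q w + spray_struct w *v q w - conn_matrix w *v q w)"
  unfolding dyn_deriv_def
  by (rule represents_cong[OF represents_add[OF
          represents_hproj[OF represents_pbracket[OF represents_hproj[OF assms]]]
          represents_vproj[OF represents_pbracket[OF represents_vproj[OF assms]]]]])
    (simp_all add: spray_deriv_zero conn_matrix_mult algebra_simps matrix_vector_mult_diff_distrib
      matrix_vector_right_distrib vec_eq_iff linear_neg[OF matrix_vector_mul_linear])

text \<open>This is \<open>\<Phi> = v \<circ> [S, h \<cdot>]\<close> in coordinates. The second coefficient \<open>q\<close> drops out, as \<open>\<Phi>\<close>
  annihilates vertical sections. The derivative \<open>D (B p)\<close> is not expanded by the product rule, since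
  it cancels as a whole in the end.\<close>

lemma represents_jacobi_endo:
  assumes "represents Z p q"
  shows "represents (jacobi_endo A c S Z) (\<lambda>_. 0)
     (\<lambda>w. spray_deriv (\<lambda>w. conn_matrix w *v p w) w - base_jacobian w *v p w - fibre_jacobian w *v (conn_matrix w *v p w)
        - conn_matrix w *v (spray_deriv p w + spray_struct w *v p w - conn_matrix w *v p w))"
proof -
  have smooth: "smooth_field p" "smooth_field q"
    using assms by (auto simp: represents_def)
  have D: "spray_deriv (\<lambda>w. q w - conn_matrix w *v p w) w = spray_deriv q w - spray_deriv (\<lambda>w. conn_matrix w *v p w) w"
    if "w \<in> region" for w
    using smooth that by (intro spray_deriv_diff) (auto intro!: smooth_field_intros)
  show ?thesis
    unfolding jacobi_endo_def lie_deriv_tensor_def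
    by (rule represents_cong[OF represents_scale[OF represents_vproj[OF represents_diff[OF
            represents_pbracket[OF represents_vproj[OF assms]]
            represents_vproj[OF represents_pbracket[OF assms]]]], of "- 1"]])
      (simp_all add: spray_deriv_zero D algebra_simps matrix_vector_mult_diff_distrib
        matrix_vector_right_distrib linear_neg[OF matrix_vector_mul_linear])
qed

definition fibre_deriv :: "('e \<Rightarrow> real ^ 'm) \<Rightarrow> 'e \<Rightarrow> real ^ 'm" where
  "fibre_deriv p w = (\<chi> \<alpha>. \<Sum>\<beta>\<in>UNIV. Vcoeff c S w $ \<beta> * partial_y A c \<beta> w (\<lambda>e. p e $ \<alpha>))"

lemma smooth_field_fibre_deriv: "smooth_field p \<Longrightarrow> smooth_field (fibre_deriv p)"
  using smooth_field_spray
  by (auto simp: smooth_field_def fibre_deriv_def partial_y_def intro!: chart_smooth_sum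
      chart_smooth_mult chart_smooth_ddir)

end

section \<open>Lifts and Lie symmetries\<close>

locale symmetry_chart = semispray_chart A c S
  for A :: "('p, 'e, 'n::finite, 'm::finite) alg" and c :: "('p, 'e, 'n, 'm) bchart" and S :: "'e psection" +
  fixes X :: "'e \<Rightarrow> 'e"
  assumes fibre_dep_section: "fibre_dep_section A X"
begin

definition component :: "'e \<Rightarrow> real ^ 'm" where
  "component w = yc c (X w)"

text \<open>The vertical coefficients of the complete lift: subtracting the fibre derivative leaves
  the part of the derivative along \<open>S\<close> that differentiates in the base directions.\<close>

definition lift_vert :: "'e \<Rightarrow> real ^ 'm" where
  "lift_vert w = spray_deriv component w + spray_struct w *v component w - fibre_deriv component w"

lemma smooth_field_component: "smooth_field component"
proof -
  have "smooth_on (coord ` region) (yc c \<circ> X \<circ> point)"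
    using fibre_dep_section chart unfolding fibre_dep_section_def by blast
  then have "smooth_on (coord ` region) (component \<circ> point)"
    by (simp add: comp_def component_def)
  then show ?thesis
    by (simp add: smooth_field_def chart_smooth_component)
qed

lemma smooth_field_lift_vert: "smooth_field lift_vert"
  unfolding lift_vert_def
  by (intro smooth_field_intros smooth_field_fibre_deriv smooth_field_component)

lemma represents_vert_lift: "represents (vert_lift A c X) (\<lambda>_. 0) component"
  using smooth_field_component smooth_field_zero by (simp add: represents_def vert_lift_def component_def)

lemma represents_compl_lift: "represents (compl_lift A c X) component lift_vert"
proof -
  have "compl_lift A c X w = frame_comb A c (component w) (lift_vert w) w" if w: "w \<in> region" for w
  proof -
    have D: "spray_deriv component w $ \<alpha> = (\<Sum>\<epsilon>\<in>UNIV. yc c w $ \<epsilon> *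
        (\<Sum>i\<in>UNIV. anchor_coeff A c \<epsilon> i (proj A w) * partial_x A c i w (\<lambda>e. component e $ \<alpha>))) + fibre_deriv component w $ \<alpha>" for \<alpha>
      by (simp add: spray_deriv_def fibre_deriv_def representsD[OF represents_spray w]
          frame_comb_def Xframe_def Vframe_def sum.distrib)
    \<comment> \<open>The complete lift contracts the second lower index of \<open>L\<close> with \<open>y\<close>, the bracket with
      \<open>S\<close> the first one.\<close>
    have "- (\<Sum>\<beta>\<in>UNIV. struct_fun A c \<beta> \<epsilon> \<alpha> (proj A w) * component w $ \<beta>) =
        (\<Sum>\<beta>\<in>UNIV. struct_fun A c \<epsilon> \<beta> \<alpha> (proj A w) * component w $ \<beta>)" for \<epsilon> \<alpha>
      using struct_fun_antisym[OF region_proj[OF w], of _ \<epsilon> \<alpha>] by (simp add: sum_negf[symmetric])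
    then have L: "(spray_struct w *v component w) $ \<alpha> = (\<Sum>\<epsilon>\<in>UNIV. yc c w $ \<epsilon> *
        - (\<Sum>\<beta>\<in>UNIV. struct_fun A c \<beta> \<epsilon> \<alpha> (proj A w) * component w $ \<beta>))" for \<alpha>
      by (simp add: spray_struct_def matrix_vector_mult_def sum_distrib_left sum_distrib_right mult_ac)
        (rule sum.swap)
    show ?thesis
      unfolding compl_lift_def frame_comb_eq_iff[OF w]
      by (simp add: vec_eq_iff lift_vert_def D L component_def[symmetric] algebra_simps sum.distrib sum_subtractf
        sum_negf)
  qed
  then show ?thesis
    using smooth_field_component smooth_field_lift_vert by (simp add: represents_def)
qed

lemma represents_bracket_compl_lift:
  "represents (pbracket A c S (compl_lift A c X)) (fibre_deriv component)
     (\<lambda>w. spray_deriv lift_vert w - base_jacobian w *v component w - fibre_jacobian w *v lift_vert w)"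
  by (rule represents_cong[OF represents_pbracket[OF represents_compl_lift]]) (simp_all add: lift_vert_def)

text \<open>Inside the second covariant derivative, \<open>D p + \<Lambda> p - B p\<close> equals \<open>q + F p - B p\<close>, where \<open>q\<close> are
  the vertical coefficients of the complete lift. The rest is linear algebra with \<open>G = 2 B - \<Lambda>\<close>.\<close>

lemma represents_jacobi:
  "represents (psec_add A (dyn_deriv A c S (dyn_deriv A c S (vert_lift A c X)))
      (jacobi_endo A c S (compl_lift A c X))) (\<lambda>_. 0)
     (\<lambda>w. (spray_deriv lift_vert w - base_jacobian w *v component w - fibre_jacobian w *v lift_vert w)
        + spray_deriv (fibre_deriv component) w - fibre_jacobian w *v fibre_deriv component w)"
proof -
  have DX: "spray_deriv component w = lift_vert w + fibre_deriv component w - spray_struct w *v component w" for w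
    by (simp add: lift_vert_def)
  have "spray_deriv (\<lambda>w. spray_deriv component w + spray_struct w *v component w - conn_matrix w *v component w) w
      = spray_deriv lift_vert w + spray_deriv (fibre_deriv component) w - spray_deriv (\<lambda>w. conn_matrix w *v component w) w"
    if "w \<in> region" for w
  proof -
    have "spray_deriv (\<lambda>w. spray_deriv component w + spray_struct w *v component w - conn_matrix w *v component w) w
      = spray_deriv (\<lambda>w. lift_vert w + fibre_deriv component w - conn_matrix w *v component w) w"
      by (simp add: DX)
    also have "\<dots> = spray_deriv (\<lambda>w. lift_vert w + fibre_deriv component w) w - spray_deriv (\<lambda>w. conn_matrix w *v component w) w"
      by (intro spray_deriv_diff smooth_field_intros smooth_field_lift_vert smooth_field_fibre_deriv
          smooth_field_component that)
    also have "spray_deriv (\<lambda>w. lift_vert w + fibre_deriv component w) w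
      = spray_deriv lift_vert w + spray_deriv (fibre_deriv component) w"
      by (intro spray_deriv_add smooth_field_lift_vert smooth_field_fibre_deriv smooth_field_component that)
    finally show ?thesis .
  qed
  then show ?thesis
    by (intro represents_cong[OF represents_add[OF
            represents_dyn_deriv_vertical[OF represents_dyn_deriv_vertical[OF represents_vert_lift]]
            represents_jacobi_endo[OF represents_compl_lift]]])
      (simp_all add: DX conn_matrix_mult algebra_simps matrix_vector_mult_diff_distrib
        matrix_vector_right_distrib vec_eq_iff)
qed

lemma fibre_const_along_iff:
  "fibre_const_along A c S X \<longleftrightarrow> (\<forall>w\<in>region. fibre_deriv component w = 0)"
  by (simp add: fibre_const_along_def fibre_deriv_def vec_eq_iff component_def)

text \<open>If \<open>F p\<close> vanishes on the whole region, which is open, then so does \<open>D (F p)\<close>, and the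
  terms by which the Jacobi equation differs from the \<open>\<V>\<close> part of the bracket disappear. If
  \<open>F p\<close> does not vanish, neither does the \<open>\<X>\<close> part of the bracket, and both sides are false.\<close>

lemma symmetry_iff_jacobi:
  "lie_symmetry_on A c S X \<longleftrightarrow>
     (\<forall>w\<in>region. psec_add A (dyn_deriv A c S (dyn_deriv A c S (vert_lift A c X)))
        (jacobi_endo A c S (compl_lift A c X)) w = pzero A w) \<and> fibre_const_along A c S X"
proof (cases "fibre_const_along A c S X")
  case True
  then have F: "fibre_deriv component w = 0" if "w \<in> region" for w
    using that by (simp add: fibre_const_along_iff)
  then have "spray_deriv (fibre_deriv component) w = 0" if "w \<in> region" for w
    using spray_deriv_cong[OF smooth_field_fibre_deriv[OF smooth_field_component], of "\<lambda>_. 0" w]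
      spray_deriv_zero that by simp
  with True F show ?thesis
    unfolding lie_symmetry_on_def
    by (simp add: represents_zero_iff[OF represents_bracket_compl_lift] represents_zero_iff[OF represents_jacobi]
        del: Int_iff)
next
  case False
  then show ?thesis
    unfolding lie_symmetry_on_def fibre_const_along_iff
    by (auto simp: represents_zero_iff[OF represents_bracket_compl_lift] simp del: Int_iff)
qed

lemma basic_imp_fibre_const:
  assumes "basic_on A c X"
  shows "fibre_const_along A c S X"
proof -
  have "partial_y A c \<beta> w (\<lambda>e. component e $ \<alpha>) = 0" if w: "w \<in> region" for w \<alpha> \<beta>
  proof -
    let ?f = "\<lambda>e. component e $ \<alpha>"
    \<comment> \<open>Near \<open>w\<close>, the coordinate line in direction \<open>y\<^sup>\<beta>\<close> stays in the fibre of \<open>w\<close> and avoids the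
      zero section, so the components of a basic section are constant along it.\<close>
    define line where "line t = coord w + t *\<^sub>R (0, axis \<beta> 1)" for t :: real
    have f: "chart_smooth ?f"
      by (rule smooth_fieldD[OF smooth_field_component])
    have line_0: "line 0 = coord w"
      by (simp add: line_def zero_prod_def[symmetric])
    have line: "(line has_derivative (\<lambda>t. t *\<^sub>R (0, axis \<beta> 1))) (at 0)"
      unfolding line_def by (auto intro!: derivative_eq_intros)
    have "((\<lambda>t. (?f \<circ> point) (line t)) has_derivative (\<lambda>t. ddir w (t *\<^sub>R (0, axis \<beta> 1)) ?f)) (at 0)"
      by (rule has_derivative_compose[OF line]) (use has_derivative_ddir[OF f w] in \<open>simp only: line_0\<close>)
    moreover have "((\<lambda>t. (?f \<circ> point) (line t)) has_derivative (\<lambda>_. 0)) (at 0)"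
    proof (rule has_derivative_transform_within_open)
      show "((\<lambda>_. ?f w) has_derivative (\<lambda>_. 0)) (at 0)"
        by simp
      show "open (line -` (coord ` region))"
        unfolding line_def by (intro open_vimage open_coord_region continuous_intros)
      show "0 \<in> line -` (coord ` region)"
        using w by (simp add: line_0)
      fix t assume "t \<in> line -` (coord ` region)"
      then obtain w' where w': "w' \<in> region" "line t = coord w'"
        by blast
      then have "xc c (proj A w') = xc c (proj A w)"
        by (simp add: line_def coord_eq)
      then have "proj A w' = proj A w"
        by (rule inj_onD[OF inj_on_base]) (use region_proj w w'(1) in blast)+
      then have "X w' = X w"
        using assms w w'(1) unfolding basic_on_def by blast
      then show "?f w = (?f \<circ> point) (line t)"
        using w' by (simp add: component_def point_coord)
    qed
    ultimately have "(\<lambda>t. ddir w (t *\<^sub>R (0, axis \<beta> 1)) ?f) = (\<lambda>_. 0)"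
      by (rule has_derivative_unique)
    from fun_cong[OF this, of 1] show ?thesis
      by (simp add: partial_y_def)
  qed
  then show ?thesis
    by (simp add: fibre_const_along_iff fibre_deriv_def vec_eq_iff)
qed

end

theorem proposition15:
  fixes A :: "('p, 'e, 'n::finite, 'm::finite) alg"
    and c :: "('p, 'e, 'n, 'm) bchart"
    and S :: "'e psection"
    and X :: "'e \<Rightarrow> 'e"
  assumes "lie_algebroid A"
    and "c \<in> atlas A"
    and "semispray A S"
    and "fibre_dep_section A X"
  defines "jacobi_eq \<equiv> (\<forall>w\<in>edom A c \<inter> nonzero A.
      psec_add A (dyn_deriv A c S (dyn_deriv A c S (vert_lift A c X)))
                 (jacobi_endo A c S (compl_lift A c X)) w = pzero A w)"
  shows "(basic_on A c X \<longrightarrow> (lie_symmetry_on A c S X \<longleftrightarrow> jacobi_eq)) \<and>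
         (lie_symmetry_on A c S X \<longleftrightarrow> jacobi_eq \<and> fibre_const_along A c S X)"
proof -
  interpret symmetry_chart A c S X
    using assms(1-4) by unfold_locales
  show ?thesis
    unfolding jacobi_eq_def using symmetry_iff_jacobi basic_imp_fibre_const by blast
qed

end
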